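(* Let $(X,d,\mu)$, $p$, $\underline{Q}_\mu$ be as in the context, let $\theta\in(0,\underline{Q}_\mu)$ and let $S\in\mathcal{ADR}_\theta(X)$. Let $s>0$ and $p\in(1,\infty)$. Then a function $f\in L_p(\mathcal H_\theta\lfloor_S)$ belongs to $\mathrm B^s_p(S)$ if and only if $$\widetilde{\mathcal{BN}}^s_p(f):=\Big(\sum_{k=1}^\infty2^{ksp}\int_S\frac{1}{\mathcal H_\theta(B_k(x)\cap S)}\int_{B_k(x)\cap S}|f(x)-f(y)|^p\,d\mathcal H_\theta(y)\,d\mathcal H_\theta(x)\Big)^{1/p}<+\infty.$$ Furthermore, there is a constant $C>0$ such that $$\frac1C\|f|\mathrm B^s_p(S)\|\le\|f|L_p(\mathcal H_\theta\lfloor_S)\|+\widetilde{\mathcal{BN}}^s_p(f)\le C\|f|\mathrm B^s_p(S)\|\quad\text{for all }f\in L_p(\mathcal H_\theta\lfloor_S).$$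
   Context: Standing setting: $(X,d)$ complete separable metric space, $\mu$ a Borel regular locally finite outer measure, $\operatorname{supp}\mu=X$, uniformly locally doubling (for every $R>0$, $\sup_{r\in(0,R]}\sup_x\mu(B_{2r}(x))/\mu(B_r(x))<\infty$). Balls are closed, $B_r(x)=\{y:d(x,y)\le r\}$, $B_k(x)=B_{2^{-k}}(x)$. A fixed $p\in(1,\infty)$; $X$ supports a weak local $(1,p)$-Poincaré inequality (for every $R>0$ there are $C,\lambda\ge1$ with $\inf_c\frac{1}{\mu(B_r(x))}\int_{B_r(x)}|f-c|d\mu\le Cr(\frac{1}{\mu(B_{\lambda r}(x))}\int_{B_{\lambda r}(x)}(\operatorname{lip}f)^pd\mu)^{1/p}$ for Lipschitz $f$, $x\in X$, $r\in(0,R]$). $\underline{Q}_\mu$ is the infimum of $Q>0$ such that for every $R>0$ there is $C$ with $(r_{B'}/r_B)^Q\le C\mu(B')/\mu(B)$ for balls $B'\subset B$, $0<r_{B'}\le r_B\le R$. Notation: $\mathcal E_{\mathfrak m}(g,G):=\inf_{c\in\mathbb R}\mathfrak m(G)^{-1}\int_G|g-c|d\mathfrak m$ if $\mathfrak m(G)>0$, $0$ otherwise; $\mathfrak m\lfloor_S(E)=\mathfrak m(E\cap S)$. $\mathcal H_{\theta,\delta}(E):=\inf\{\sum\mu(B_{r_i}(x_i))r_i^{-\theta}:E\subset\bigcup B_{r_i}(x_i),0<r_i<\delta\}$ (countable covers), $\mathcal H_\theta=\lim_{\delta\to0}\mathcal H_{\theta,\delta}$. $S\in\mathcal{ADR}_\theta(X)$: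 $S$ closed and there are $\varkappa_1,\varkappa_2>0$ with $\varkappa_1\mu(B_r(x))r^{-\theta}\le\mathcal H_\theta(B_r(x)\cap S)\le\varkappa_2\mu(B_r(x))r^{-\theta}$ for all $x\in S$, $r\in(0,1]$. Besov space: $\|f|\mathrm B^s_p(S)\|:=\|f|L_p(\mathcal H_\theta\lfloor_S)\|+\big(\sum_{k\ge1}2^{ksp}\int_S(\mathcal E_{\mathcal H_\theta\lfloor_S}(f,B_k(x)))^pd\mathcal H_\theta(x)\big)^{1/p}$, and $\mathrm B^s_p(S)$ is the set of $f\in L_p(\mathcal H_\theta\lfloor_S)$ for which this is finite. *)

theory Defs
  imports "HOL-Analysis.Analysis"
begin

text \<open>Real powers of extended nonnegative reals (with \<open>\<infinity> powr p = \<infinity>\<close>, meant for \<open>p > 0\<close>).\<close>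
definition enn_powr :: "ennreal \<Rightarrow> real \<Rightarrow> ennreal" where
  "enn_powr x p = (if x = \<infinity> then \<infinity> else ennreal (enn2real x powr p))"

definition lip :: "('a::metric_space \<Rightarrow> real) \<Rightarrow> 'a \<Rightarrow> ennreal" where
  "lip f x = Liminf (at_right 0) (\<lambda>r::real. SUP y\<in>cball x r. ennreal (\<bar>f y - f x\<bar> / r))"

definition locally_finite_meas :: "'a::metric_space measure \<Rightarrow> bool" where
  "locally_finite_meas \<mu> \<longleftrightarrow> (\<forall>x. \<exists>r>0. emeasure \<mu> (cball x r) < \<infinity>)"

definition full_support :: "'a::metric_space measure \<Rightarrow> bool" where
  "full_support \<mu> \<longleftrightarrow> (\<forall>x. \<forall>r>0. emeasure \<mu> (ball x r) > 0)"

definition unif_loc_doubling :: "'a::metric_space measure \<Rightarrow> bool" where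
  "unif_loc_doubling \<mu> \<longleftrightarrow> (\<forall>R>0. \<exists>C::real. \<forall>r\<in>{0<..R}. \<forall>x.
      emeasure \<mu> (cball x (2*r)) \<le> ennreal C * emeasure \<mu> (cball x r))"

definition weak_local_poincare :: "'a::metric_space measure \<Rightarrow> real \<Rightarrow> bool" where
  "weak_local_poincare \<mu> p \<longleftrightarrow> (\<forall>R>0. \<exists>C\<ge>1. \<exists>lam\<ge>1. \<forall>f::'a\<Rightarrow>real. \<forall>x. \<forall>r\<in>{0<..R}.
      (\<exists>L. L-lipschitz_on UNIV f) \<longrightarrow>
      (INF c::real. (\<integral>\<^sup>+ y\<in>cball x r. ennreal \<bar>f y - c\<bar> \<partial>\<mu>) / emeasure \<mu> (cball x r))
        \<le> ennreal (C * r) *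
          enn_powr ((\<integral>\<^sup>+ y\<in>cball x (lam*r). enn_powr (lip f y) p \<partial>\<mu>) / emeasure \<mu> (cball x (lam*r))) (1/p))"

definition lower_dim_cond :: "'a::metric_space measure \<Rightarrow> real \<Rightarrow> bool" where
  "lower_dim_cond \<mu> Q \<longleftrightarrow> (\<forall>R>0. \<exists>C::real. \<forall>x y r r'.
      cball y r' \<subseteq> cball x r \<and> 0 < r' \<and> r' \<le> r \<and> r \<le> R \<longrightarrow>
      (r'/r) powr Q \<le> C * measure \<mu> (cball y r') / measure \<mu> (cball x r))"

definition lower_Q :: "'a::metric_space measure \<Rightarrow> real" where
  "lower_Q \<mu> = Inf {Q. Q > 0 \<and> lower_dim_cond \<mu> Q}"

definition H_delta :: "'a::metric_space measure \<Rightarrow> real \<Rightarrow> real \<Rightarrow> 'a set \<Rightarrow> ennreal" where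
  "H_delta \<mu> \<theta> \<delta> E = (INF cov \<in> {(I, c, r) | (I::nat set) (c::nat\<Rightarrow>'a) (r::nat\<Rightarrow>real).
        E \<subseteq> (\<Union>i\<in>I. cball (c i) (r i)) \<and> (\<forall>i\<in>I. 0 < r i \<and> r i < \<delta>)}.
      (case cov of (I, c, r) \<Rightarrow>
        (\<Sum>i. if i \<in> I then emeasure \<mu> (cball (c i) (r i)) * ennreal (r i powr (-\<theta>)) else 0)))"

definition H_theta :: "'a::metric_space measure \<Rightarrow> real \<Rightarrow> 'a set \<Rightarrow> ennreal" where
  "H_theta \<mu> \<theta> E = (SUP \<delta>\<in>{0<..}. H_delta \<mu> \<theta> \<delta> E)"

definition ADR :: "'a::metric_space measure \<Rightarrow> real \<Rightarrow> 'a set \<Rightarrow> bool" where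
  "ADR \<mu> \<theta> S \<longleftrightarrow> closed S \<and> (\<exists>k1>0. \<exists>k2>0. \<forall>x\<in>S. \<forall>r\<in>{0<..1}.
      ennreal k1 * emeasure \<mu> (cball x r) * ennreal (r powr (-\<theta>)) \<le> H_theta \<mu> \<theta> (cball x r \<inter> S) \<and>
      H_theta \<mu> \<theta> (cball x r \<inter> S) \<le> ennreal k2 * emeasure \<mu> (cball x r) * ennreal (r powr (-\<theta>)))"

definition H_restr :: "'a::metric_space measure \<Rightarrow> real \<Rightarrow> 'a set \<Rightarrow> 'a measure" where
  "H_restr \<mu> \<theta> S = measure_of UNIV (sets borel) (\<lambda>A. H_theta \<mu> \<theta> (A \<inter> S))"

definition Lp_space :: "'a measure \<Rightarrow> real \<Rightarrow> ('a \<Rightarrow> real) set" where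
  "Lp_space m p = {f. f \<in> borel_measurable m \<and> (\<integral>\<^sup>+ x. ennreal (\<bar>f x\<bar> powr p) \<partial>m) < \<infinity>}"

definition Lp_norm :: "'a measure \<Rightarrow> real \<Rightarrow> ('a \<Rightarrow> real) \<Rightarrow> ennreal" where
  "Lp_norm m p f = enn_powr (\<integral>\<^sup>+ x. ennreal (\<bar>f x\<bar> powr p) \<partial>m) (1/p)"

definition mean_osc :: "'a measure \<Rightarrow> ('a \<Rightarrow> real) \<Rightarrow> 'a set \<Rightarrow> ennreal" where
  "mean_osc m g G = (if emeasure m G > 0
      then (INF c::real. (\<integral>\<^sup>+ y\<in>G. ennreal \<bar>g y - c\<bar> \<partial>m) / emeasure m G) else 0)"

definition besov_norm :: "'a::metric_space measure \<Rightarrow> real \<Rightarrow> 'a set \<Rightarrow> real \<Rightarrow> real \<Rightarrow> ('a \<Rightarrow> real) \<Rightarrow> ennreal" where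
  "besov_norm \<mu> \<theta> S s p f = Lp_norm (H_restr \<mu> \<theta> S) p f +
     enn_powr (\<Sum>k. if k \<ge> 1 then ennreal (2 powr (real k * s * p)) *
        (\<integral>\<^sup>+ x\<in>S. enn_powr (mean_osc (H_restr \<mu> \<theta> S) f (cball x (2 powr (- real k)))) p
           \<partial>(H_restr \<mu> \<theta> S)) else 0) (1/p)"

definition besov_space :: "'a::metric_space measure \<Rightarrow> real \<Rightarrow> 'a set \<Rightarrow> real \<Rightarrow> real \<Rightarrow> ('a \<Rightarrow> real) set" where
  "besov_space \<mu> \<theta> S s p = {f \<in> Lp_space (H_restr \<mu> \<theta> S) p. besov_norm \<mu> \<theta> S s p f < \<infinity>}"

definition BN_tilde :: "'a::metric_space measure \<Rightarrow> real \<Rightarrow> 'a set \<Rightarrow> real \<Rightarrow> real \<Rightarrow> ('a \<Rightarrow> real) \<Rightarrow> ennreal" where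
  "BN_tilde \<mu> \<theta> S s p f =
     enn_powr (\<Sum>k. if k \<ge> 1 then ennreal (2 powr (real k * s * p)) *
        (\<integral>\<^sup>+ x\<in>S. (1 / H_theta \<mu> \<theta> (cball x (2 powr (- real k)) \<inter> S)) *
            (\<integral>\<^sup>+ y\<in>cball x (2 powr (- real k)) \<inter> S. ennreal (\<bar>f x - f y\<bar> powr p) \<partial>(H_restr \<mu> \<theta> S))
           \<partial>(H_restr \<mu> \<theta> S)) else 0) (1/p)"

end

(* Write m for the restriction of H_theta to S, B_k(x) for the ball of radius 2^-k, A_k f for the
   average of f over B_k(x) and E_k for its mean oscillation there. Ahlfors regularity makes m
   doubling on S, and testing the infimum in E_k with c = f(x) gives one inequality by Jensen.

   For the other one, |A_{j+1} f - A_j f| is at most a constant times E_j, and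
   |A_k f(x) - A_k f(y)| <= C E_{k-1}(x) for y in B_k(x). So the L_p oscillation of f at scale k is
   controlled by E_{k-1} and by the sum over j >= k of the E_j, provided that A_N f tends to f in L_p.
   This replaces Lebesgue differentiation, and follows from the decay of the L_p oscillation itself:
   it is clear for indicators of open sets by dominated convergence and symmetry, and passes to all of
   L_p by outer regularity and density. A discrete Hardy inequality sums over the scales; the scale
   k = 1, for which E_0 is not available, is bounded by the L_p norm. *)

theory Submission
  imports Defs
begin

section \<open>Powers\<close>

text \<open>Two obstacles shape the proof. \<open>H_restr\<close> is formed with
  \<open>measure_of\<close>, which returns the zero measure unless the given set function is a
  measure on the Borel sets; no ball has positive mass until Caratheodory's criterion has been
  verified for \<open>H_theta\<close>. Secondly, the mean oscillation is an infimum over all real c,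
  and its measurability in x is never established: its integrals are compared by monotonicity alone,
  and constants are taken only out of integrals of other functions. The Hardy step needs smoothness
  twice, once to sum the increments of the averages over j >= k and once to sum over k, so s is
  split into two halves; this is the origin of \<open>Q = 2 powr (s * p / 2)\<close>. Up to the
  Hausdorff measure, only a doubling measure concentrated on S appears, with conditions on radii at
  most 1, because the regularity of S says nothing about larger balls.\<close>

lemma enn_powr_ennreal [simp]: "0 \<le> a \<Longrightarrow> enn_powr (ennreal a) p = ennreal (a powr p)"
  by (simp add: enn_powr_def)

lemma enn_powr_top [simp]: "enn_powr top p = top"
  by (simp add: enn_powr_def)

lemma enn_powr_less_top_iff: "enn_powr x q < top \<longleftrightarrow> x < top"
  by (cases x) auto

lemma enn_powr_mono: "0 \<le> p \<Longrightarrow> x \<le> y \<Longrightarrow> enn_powr x p \<le> enn_powr y p"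
  by (cases x; cases y) (auto simp: ennreal_leI powr_mono2 top_unique)

lemma enn_powr_mult: "0 < c \<Longrightarrow> enn_powr (ennreal c * x) p = ennreal (c powr p) * enn_powr x p"
  by (cases x) (auto simp: powr_mult ennreal_mult_top simp flip: ennreal_mult)

text \<open>Passing through twice the maximum covers every q >= 0, in particular the root q = 1/p <
  1 that enters the final comparison of norms.\<close>

lemma enn_powr_add_le:
  assumes "0 \<le> q"
  shows "enn_powr (x + y) q \<le> ennreal (2 powr q) * (enn_powr x q + enn_powr y q)"
proof -
  have "x + y \<le> ennreal 2 * max x y"
    by (metis add_mono ennreal_numeral max.cobounded1 max.cobounded2 mult_2)
  then have "enn_powr (x + y) q \<le> ennreal (2 powr q) * enn_powr (max x y) q"
    using enn_powr_mono[OF assms] by (simp only: enn_powr_mult[symmetric] zero_less_numeral)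
  also have "\<dots> \<le> ennreal (2 powr q) * (enn_powr x q + enn_powr y q)"
    by (intro mult_left_mono) (auto simp: max_def)
  finally show ?thesis .
qed

lemma abs_powr_add_le:
  fixes a b p :: real
  assumes "0 \<le> p"
  shows "\<bar>a + b\<bar> powr p \<le> 2 powr p * (\<bar>a\<bar> powr p + \<bar>b\<bar> powr p)"
proof -
  have "\<bar>a + b\<bar> powr p \<le> (2 * max \<bar>a\<bar> \<bar>b\<bar>) powr p"
    using assms by (intro powr_mono2) auto
  also have "\<dots> = 2 powr p * max \<bar>a\<bar> \<bar>b\<bar> powr p"
    by (simp add: powr_mult)
  also have "\<dots> \<le> 2 powr p * (\<bar>a\<bar> powr p + \<bar>b\<bar> powr p)"
    by (intro mult_left_mono) (auto simp: max_def)
  finally show ?thesis .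
qed

text \<open>The sum of increments is a geometric series times the largest weighted increment, and the
  \<open>p\<close>-th power of that maximum is at most the sum of the \<open>p\<close>-th powers.\<close>

lemma abs_diff_powr_le_weighted_sum:
  fixes a :: "nat \<Rightarrow> real" and e p :: real
  assumes "0 < e" "0 \<le> p" "k \<le> N"
  shows "\<bar>a N - a k\<bar> powr p \<le> (1 / (1 - 2 powr (- e))) powr p * 2 powr (- (real k * e * p)) *
           (\<Sum>j=k..<N. 2 powr (real j * e * p) * \<bar>a (Suc j) - a j\<bar> powr p)"
\<comment> \<open>For k = N there is no increment, and the maximum below would be taken over an
  empty set.\<close>
proof (cases "k = N")
  case False
  with assms have kN: "k < N" by simp
  define q where "q = 2 powr (- e)"
  have q: "0 < q" "q < 1"
    using assms by (auto simp: q_def powr_less_one)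
  have qj: "q ^ j = 2 powr (- (real j * e))" for j
    by (simp add: q_def powr_powr powr_realpow[symmetric] mult.commute)
  define b where "b = (\<lambda>j. 2 powr (real j * e) * \<bar>a (Suc j) - a j\<bar>)"
  define M where "M = Max (b ` {k..<N})"
  have bM: "b j \<le> M" if "j \<in> {k..<N}" for j
    unfolding M_def using that by (intro Max_ge) auto
  have "M \<in> b ` {k..<N}"
    unfolding M_def using kN by (intro Max_in) auto
  then obtain i where i: "i \<in> {k..<N}" "M = b i" by auto
  have M0: "0 \<le> M" using i by (simp add: b_def)
  have inc: "\<bar>a (Suc j) - a j\<bar> = q ^ j * b j" for j
    unfolding b_def qj by (simp add: powr_minus field_simps)
  have "\<bar>a N - a k\<bar> = \<bar>\<Sum>j=k..<N. a (Suc j) - a j\<bar>"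
    using assms(3) by (simp add: sum_Suc_diff')
  also have "\<dots> \<le> (\<Sum>j=k..<N. q ^ j * b j)"
    unfolding inc[symmetric] by (rule sum_abs)
  also have "\<dots> \<le> (\<Sum>j=k..<N. q ^ j * M)"
    using bM q by (intro sum_mono mult_left_mono) auto
  also have "\<dots> = (\<Sum>j=k..<N. q ^ j) * M"
    by (simp add: sum_distrib_right)
  also have "\<dots> \<le> q ^ k / (1 - q) * M"
  proof (intro mult_right_mono M0)
    have "(1 - q) * (\<Sum>j=k..<N. q ^ j) = - (\<Sum>j=k..<N. q ^ Suc j - q ^ j)"
      unfolding sum_distrib_left sum_negf[symmetric] by (intro sum.cong) (auto simp: algebra_simps)
    also have "\<dots> = q ^ k - q ^ N"
      using assms(3) by (subst sum_Suc_diff') auto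
    finally have "(\<Sum>j=k..<N. q ^ j) = (q ^ k - q ^ N) / (1 - q)"
      using q by (simp add: field_simps)
    also have "\<dots> \<le> q ^ k / (1 - q)"
      using q by (intro divide_right_mono) auto
    finally show "(\<Sum>j=k..<N. q ^ j) \<le> q ^ k / (1 - q)" .
  qed
  finally have "\<bar>a N - a k\<bar> powr p \<le> (q ^ k / (1 - q) * M) powr p"
    using assms by (intro powr_mono2) auto
  also have "\<dots> = (1 / (1 - q)) powr p * 2 powr (- (real k * e * p)) * M powr p"
    using q M0 by (simp add: powr_mult powr_divide qj powr_powr)
  also have "\<dots> \<le> (1 / (1 - q)) powr p * 2 powr (- (real k * e * p)) *
      (\<Sum>j=k..<N. b j powr p)"
    unfolding i(2) using i(1)
    by (intro mult_left_mono member_le_sum[of i _ "\<lambda>j. b j powr p"]) auto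
  also have "(\<lambda>j. b j powr p) = (\<lambda>j. 2 powr (real j * e * p) * \<bar>a (Suc j) - a j\<bar> powr p)"
    by (simp add: b_def powr_mult powr_powr)
  finally show ?thesis by (simp add: q_def)
qed (use assms in simp)

section \<open>Averages over balls of a doubling measure\<close>

lemma cball_subset_cball_of_dist: "dist x y + r \<le> s \<Longrightarrow> cball y r \<subseteq> cball x s"
proof
  fix z assume "dist x y + r \<le> s" "z \<in> cball y r"
  then show "z \<in> cball x s"
    using dist_triangle[of x z y] by simp
qed

text \<open>This is what remains of Ahlfors regularity once theta and the ambient measure are
  forgotten. Mass bounds are available for centres in S and radii up to 1, hence doubling is stated
  up to radius 1/2; all estimates therefore hold at points of S and are integrated almost
  everywhere.\<close>

locale doubling_on =
  fixes m :: "'a::polish_space measure" and S :: "'a set" and D :: real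
  assumes sets_m [measurable_cong]: "sets m = sets borel"
    and AE_S: "AE x in m. x \<in> S"
    and ball_pos: "\<And>x r. x \<in> S \<Longrightarrow> 0 < r \<Longrightarrow> r \<le> 1 \<Longrightarrow> 0 < emeasure m (cball x r)"
    and ball_finite: "\<And>x r. x \<in> S \<Longrightarrow> 0 < r \<Longrightarrow> r \<le> 1 \<Longrightarrow> emeasure m (cball x r) < top"
    and ball_doubling: "\<And>x r. x \<in> S \<Longrightarrow> 0 < r \<Longrightarrow> r \<le> 1/2 \<Longrightarrow>
          emeasure m (cball x (2 * r)) \<le> ennreal D * emeasure m (cball x r)"
    and D_ge_1: "1 \<le> D"
begin

lemma space_m [simp]: "space m = UNIV"
  using sets_eq_imp_space_eq[OF sets_m] by simp

lemma cball_sets [measurable, simp]: "cball x r \<in> sets m"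
  by (simp add: sets_m)

text \<open>Lindelof's theorem for the unit balls centred in S. The empty set is inserted so that
  the family can be enumerated even when S is empty.\<close>

lemma countable_open_cover:
  obtains W :: "nat \<Rightarrow> 'a set"
  where "\<And>i. open (W i)" "\<And>i. emeasure m (W i) < top" "S \<subseteq> (\<Union>i. W i)"
proof -
  define F where "F = insert {} ((\<lambda>x. ball x 1) ` S)"
  obtain F' where F': "F' \<subseteq> F" "countable F'" "\<Union>F' = \<Union>F"
    using Lindelof[of F] unfolding F_def by blast
  have fin: "emeasure m A < top" if "A \<in> F" for A
  proof -
    have "emeasure m (ball x 1) < top" if "x \<in> S" for x
      using emeasure_mono[OF ball_subset_cball cball_sets, of x 1] ball_finite[of x 1] that
      by (auto intro: le_less_trans)
    with that show ?thesis by (auto simp: F_def)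
  qed
  define W where "W = from_nat_into (insert {} F')"
  have W: "range W = insert {} F'"
    unfolding W_def using F'(2) by (intro range_from_nat_into) auto
  have "W i \<in> F" for i
    using rangeI[of W i] F'(1) unfolding W by (auto simp: F_def)
  moreover have "S \<subseteq> (\<Union>i. W i)"
    unfolding W using F'(3) by (auto simp: F_def)
  moreover have "open A" if "A \<in> F" for A
    using that by (auto simp: F_def)
  ultimately show ?thesis
    using that fin by blast
qed

text \<open>Needed for Fubini's theorem. What the countable cover misses lies outside S and is a
  null set, so it can be added as one more set of finite mass.\<close>

sublocale sigma_finite_measure m
proof
  obtain W :: "nat \<Rightarrow> 'a set" where W: "\<And>i. open (W i)" "\<And>i. emeasure m (W i) < top" "S \<subseteq> (\<Union>i. W i)"
    using countable_open_cover by blast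
  define Z where "Z = - (\<Union>i. W i)"
  have Z: "Z \<in> sets m"
    unfolding Z_def using W(1) by (auto simp: sets_m intro!: borel_closed)
  have "emeasure m Z = emeasure m {}"
    using AE_S W(3) Z by (intro emeasure_eq_AE) (auto simp: Z_def elim!: eventually_mono)
  then have "emeasure m Z \<noteq> \<infinity>" by simp
  with W(2) Z W(1) show "\<exists>A. countable A \<and> A \<subseteq> sets m \<and> \<Union> A = space m \<and> (\<forall>a\<in>A. emeasure m a \<noteq> \<infinity>)"
    by (intro exI[of _ "insert Z (range W)"]) (auto simp: Z_def sets_m less_top)
qed

lemma pair_sigma_finite_m: "pair_sigma_finite m m"
  by (intro pair_sigma_finite.intro sigma_finite_measure_axioms)

text \<open>Through the distance function the indicator is measurable jointly in centre and point,
  which is what double integrals over moving balls require.\<close>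

lemma measurable_indicator_cball [measurable (raw)]:
  fixes f g :: "'b \<Rightarrow> 'a"
  assumes [measurable]: "f \<in> measurable N borel" "g \<in> measurable N borel"
  shows "(\<lambda>z. indicator (cball (f z) r) (g z) :: 'c::{topological_space, zero_neq_one}) \<in> borel_measurable N"
proof -
  have "(\<lambda>z. indicator (cball (f z) r) (g z) :: 'c) = (\<lambda>z. if dist (f z) (g z) \<le> r then 1 else 0)"
    by (auto simp: indicator_def)
  then show ?thesis by simp
qed

lemma measurable_emeasure_cball [measurable]: "(\<lambda>x. emeasure m (cball x r)) \<in> borel_measurable m"
proof -
  have "(\<lambda>x. emeasure m (cball x r)) = (\<lambda>x. \<integral>\<^sup>+ y. indicator (cball x r) y \<partial>m)"
    by simp
  also have "\<dots> \<in> borel_measurable m" by measurable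
  finally show ?thesis .
qed

lemma measurable_measure_cball [measurable]: "(\<lambda>x. measure m (cball x r)) \<in> borel_measurable m"
  unfolding measure_def by measurable

text \<open>The ball about y lies in the doubled ball about x. This moves the normalising factor of
  an average from one centre to the other.\<close>

lemma inverse_ball_le:
  assumes "x \<in> S" "y \<in> S" "dist x y \<le> r" "0 < r" "r \<le> 1/2"
  shows "inverse (emeasure m (cball x r)) \<le> ennreal D * inverse (emeasure m (cball y r))"
proof -
  have "emeasure m (cball y r) \<le> emeasure m (cball x (2 * r))"
    using assms by (intro emeasure_mono) (auto intro!: cball_subset_cball_of_dist)
  also have "\<dots> \<le> ennreal D * emeasure m (cball x r)"
    using assms by (intro ball_doubling)
  finally have *: "emeasure m (cball y r) \<le> ennreal D * emeasure m (cball x r)" .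
  obtain a where a: "emeasure m (cball x r) = ennreal a" "0 < a"
    using ball_pos[of x r] ball_finite[of x r] assms by (cases "emeasure m (cball x r)") auto
  obtain b where b: "emeasure m (cball y r) = ennreal b" "0 < b"
    using ball_pos[of y r] ball_finite[of y r] assms by (cases "emeasure m (cball y r)") auto
  have "b \<le> D * a"
    using * a b D_ge_1 by (simp flip: ennreal_mult)
  then have "inverse a \<le> D * inverse b"
    using a b by (simp add: field_simps)
  then show ?thesis
    using a b D_ge_1 by (simp add: inverse_ennreal ennreal_leI flip: ennreal_mult)
qed

text \<open>Averages with extended nonnegative values, so that no integrability has to be carried
  along; signed functions are averaged by \<open>ball_mean\<close>.\<close>

definition ball_avg :: "real \<Rightarrow> ('a \<Rightarrow> ennreal) \<Rightarrow> 'a \<Rightarrow> ennreal" where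
  "ball_avg r u x = (\<integral>\<^sup>+ y. u y * indicator (cball x r) y \<partial>m) / emeasure m (cball x r)"

lemma measurable_ball_avg [measurable]:
  assumes [measurable]: "case_prod u \<in> borel_measurable (m \<Otimes>\<^sub>M m)"
  shows "(\<lambda>x. ball_avg r (u x) x) \<in> borel_measurable m"
  unfolding ball_avg_def by measurable

lemma ball_avg_mono:
  assumes "\<And>y. y \<in> S \<Longrightarrow> y \<in> cball x r \<Longrightarrow> u y \<le> v y"
  shows "ball_avg r u x \<le> ball_avg r v x"
  unfolding ball_avg_def
proof (intro divide_right_mono_ennreal nn_integral_mono_AE)
  show "AE y in m. u y * indicator (cball x r) y \<le> v y * indicator (cball x r) y"
    using AE_S by eventually_elim (use assms in \<open>auto simp: indicator_def\<close>)
qed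

lemma ball_avg_const:
  assumes "x \<in> S" "0 < r" "r \<le> 1"
  shows "ball_avg r (\<lambda>_. c) x = c"
  using ball_pos[OF assms] ball_finite[OF assms]
  by (simp only: ball_avg_def nn_integral_cmult_indicator cball_sets) (simp add: ennreal_mult_divide_eq)

lemma ball_avg_add:
  assumes [measurable]: "u \<in> borel_measurable m" "v \<in> borel_measurable m"
  shows "ball_avg r (\<lambda>y. u y + v y) x = ball_avg r u x + ball_avg r v x"
  unfolding ball_avg_def distrib_right by (subst nn_integral_add) (auto simp: add_divide_distrib_ennreal)

lemma ball_avg_cmult:
  assumes [measurable]: "u \<in> borel_measurable m"
  shows "ball_avg r (\<lambda>y. c * u y) x = c * ball_avg r u x"
  unfolding ball_avg_def mult.assoc by (subst nn_integral_cmult) (auto simp: ennreal_times_divide)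

text \<open>The relation dist x y <= r is symmetric, so Fubini's theorem exchanges the roles of x
  and y; only the normalising masses differ, and they are comparable up to D.\<close>

lemma nn_integral_ball_avg_swap_le:
  assumes [measurable]: "case_prod u \<in> borel_measurable (m \<Otimes>\<^sub>M m)"
    and r: "0 < r" "r \<le> 1/2"
  shows "(\<integral>\<^sup>+ x. ball_avg r (u x) x \<partial>m) \<le> ennreal D * (\<integral>\<^sup>+ y. ball_avg r (\<lambda>x. u x y) y \<partial>m)"
proof -
  interpret P: pair_sigma_finite m m by (rule pair_sigma_finite_m)
  have "(\<integral>\<^sup>+ x. ball_avg r (u x) x \<partial>m) =
      (\<integral>\<^sup>+ x. \<integral>\<^sup>+ y. u x y * indicator (cball x r) y * inverse (emeasure m (cball x r)) \<partial>m \<partial>m)"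
    unfolding ball_avg_def divide_ennreal_def
    by (intro nn_integral_cong nn_integral_multc[symmetric]) measurable
  also have "\<dots> = (\<integral>\<^sup>+ y. \<integral>\<^sup>+ x. u x y * indicator (cball x r) y * inverse (emeasure m (cball x r)) \<partial>m \<partial>m)"
    by (subst P.Fubini') (auto simp: split_beta')
  also have "\<dots> \<le> (\<integral>\<^sup>+ y. \<integral>\<^sup>+ x. ennreal D * (u x y * indicator (cball y r) x * inverse (emeasure m (cball y r))) \<partial>m \<partial>m)"
  proof (rule nn_integral_mono_AE)
    have le: "u x y * indicator (cball x r) y * inverse (emeasure m (cball x r)) \<le>
        ennreal D * (u x y * indicator (cball y r) x * inverse (emeasure m (cball y r)))"
      if "x \<in> S" "y \<in> S" for x y
    proof (cases "dist x y \<le> r")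
      case True
      have "u x y * inverse (emeasure m (cball x r)) \<le> u x y * (ennreal D * inverse (emeasure m (cball y r)))"
        using inverse_ball_le[OF that True r] by (intro mult_left_mono) auto
      then show ?thesis using True by (simp add: dist_commute mult_ac)
    qed simp
    show "AE y in m. (\<integral>\<^sup>+ x. u x y * indicator (cball x r) y * inverse (emeasure m (cball x r)) \<partial>m) \<le>
        (\<integral>\<^sup>+ x. ennreal D * (u x y * indicator (cball y r) x * inverse (emeasure m (cball y r))) \<partial>m)"
      using AE_S
    proof eventually_elim
      case (elim y)
      show ?case
        using AE_S by (intro nn_integral_mono_AE) (auto elim!: eventually_mono intro: le elim)
    qed
  qed
  also have "\<dots> = ennreal D * (\<integral>\<^sup>+ y. ball_avg r (\<lambda>x. u x y) y \<partial>m)"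
    unfolding ball_avg_def divide_ennreal_def
    by (simp add: nn_integral_cmult nn_integral_multc)
  finally show ?thesis .
qed

text \<open>Averaging is bounded on L_1: after the exchange the integrand is constant on each
  ball.\<close>

lemma nn_integral_ball_avg_le:
  assumes [measurable]: "u \<in> borel_measurable m" and r: "0 < r" "r \<le> 1/2"
  shows "(\<integral>\<^sup>+ x. ball_avg r u x \<partial>m) \<le> ennreal D * (\<integral>\<^sup>+ y. u y \<partial>m)"
proof -
  have "(\<integral>\<^sup>+ x. ball_avg r u x \<partial>m) \<le> ennreal D * (\<integral>\<^sup>+ y. ball_avg r (\<lambda>x. u y) y \<partial>m)"
    using r by (intro nn_integral_ball_avg_swap_le[of "\<lambda>x y. u y"]) auto
  also have "(\<integral>\<^sup>+ y. ball_avg r (\<lambda>x. u y) y \<partial>m) = (\<integral>\<^sup>+ y. u y \<partial>m)"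
    using AE_S r by (intro nn_integral_cong_AE) (auto elim!: eventually_mono simp: ball_avg_const)
  finally show ?thesis .
qed

text \<open>Jensen's inequality up to the factor \<open>2 powr p\<close>, from
  \<open>u * t powr (p - 1) \<le> u powr p + t powr p\<close> with \<open>t powr p\<close> the average of \<open>u powr p\<close>.\<close>

lemma enn_powr_ball_avg_le:
  fixes u :: "'a \<Rightarrow> real"
  assumes [measurable]: "u \<in> borel_measurable m" and u: "\<And>y. 0 \<le> u y" and p: "1 < p"
    and x: "x \<in> S" "0 < r" "r \<le> 1"
  shows "enn_powr (ball_avg r u x) p \<le> ennreal (2 powr p) * ball_avg r (\<lambda>y. ennreal (u y powr p)) x"
proof (cases "ball_avg r (\<lambda>y. ennreal (u y powr p)) x")
  case top
  then show ?thesis by (simp add: ennreal_mult_top)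
next
  case (real A)
  have bnd: "ball_avg r u x \<le> ennreal (2 * A powr (1/p))"
  proof (rule ennreal_le_epsilon)
    fix e :: real assume "0 < e"
    \<comment> \<open>The summand e / 2 keeps t positive when A = 0, and makes 2 * t exactly the
      bound that is to be reached.\<close>
    define t where "t = A powr (1/p) + e / 2"
    have t: "0 < t" "A \<le> t powr p"
    proof -
      show "0 < t" using \<open>0 < e\<close> by (simp add: t_def add_nonneg_pos)
      have "A = (A powr (1/p)) powr p" using real p by (simp add: powr_powr)
      also have "\<dots> \<le> t powr p" using \<open>0 < e\<close> p by (intro powr_mono2) (auto simp: t_def)
      finally show "A \<le> t powr p" .
    qed
    have le: "u y \<le> t powr (1 - p) * (u y powr p + t powr p)" for y
    proof (cases "u y \<le> t")
      case True
      have "u y \<le> t powr (1 - p) * t powr p" using True t by (simp flip: powr_add)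
      also have "\<dots> \<le> t powr (1 - p) * (u y powr p + t powr p)"
        by (intro mult_left_mono) auto
      finally show ?thesis .
    next
      case False
      then have "0 < u y" using t by simp
      then have "u y = u y powr (1 - p) * u y powr p" by (simp flip: powr_add)
      also have "\<dots> \<le> t powr (1 - p) * u y powr p"
        using False t p by (intro mult_right_mono powr_mono2') auto
      also have "\<dots> \<le> t powr (1 - p) * (u y powr p + t powr p)"
        by (intro mult_left_mono) auto
      finally show ?thesis .
    qed
    have "ball_avg r u x \<le> ball_avg r (\<lambda>y. ennreal (t powr (1 - p)) * (ennreal (u y powr p) + ennreal (t powr p))) x"
      by (intro ball_avg_mono) (use le in \<open>auto simp flip: ennreal_plus ennreal_mult intro!: ennreal_leI\<close>)
    also have "\<dots> = ennreal (t powr (1 - p)) * (ennreal A + ennreal (t powr p))"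
      using x by (simp add: ball_avg_cmult ball_avg_add ball_avg_const real)
    also have "\<dots> \<le> ennreal (t powr (1 - p) * (t powr p + t powr p))"
      using t real by (auto simp flip: ennreal_plus ennreal_mult intro!: ennreal_leI mult_left_mono)
    also have "t powr (1 - p) * (t powr p + t powr p) = 2 * t"
      using t by (simp add: distrib_left flip: powr_add)
    also have "ennreal (2 * t) = ennreal (2 * A powr (1/p)) + ennreal e"
      using \<open>0 < e\<close> by (simp add: t_def flip: ennreal_plus)
    finally show "ball_avg r u x \<le> ennreal (2 * A powr (1/p)) + ennreal e" .
  qed
  have "enn_powr (ball_avg r u x) p \<le> enn_powr (ennreal (2 * A powr (1/p))) p"
    using p by (intro enn_powr_mono bnd) auto
  also have "\<dots> = ennreal (2 powr p) * ennreal A"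
    using p real by (subst enn_powr_ennreal) (simp_all add: powr_mult powr_powr ennreal_mult)
  finally show ?thesis using real by simp
qed

end

section \<open>Decay of the $L_p$ oscillation\<close>

lemma tendsto_0_ennrealI:
  fixes f :: "'b \<Rightarrow> ennreal"
  assumes "\<And>e. 0 < e \<Longrightarrow> eventually (\<lambda>n. f n \<le> ennreal e) F"
  shows "(f \<longlongrightarrow> 0) F"
proof (rule order_tendstoI)
  fix a :: ennreal assume "0 < a"
  then obtain b where b: "0 < b" "b < a" using dense by blast
  then obtain e where e: "b = ennreal e" "0 < e" by (cases b) auto
  show "eventually (\<lambda>n. f n < a) F"
    using assms[OF e(2)] by eventually_elim (use b e in auto)
qed simp

context doubling_on
begin

text \<open>For r = 2^-k this is the unweighted integral in the k-th term of
  \<open>BN_tilde\<close>.\<close>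

definition lp_osc :: "real \<Rightarrow> real \<Rightarrow> ('a \<Rightarrow> real) \<Rightarrow> ennreal" where
  "lp_osc p r f = (\<integral>\<^sup>+ x. ball_avg r (\<lambda>y. ennreal (\<bar>f x - f y\<bar> powr p)) x \<partial>m)"

lemma lp_osc_cmult:
  assumes [measurable]: "f \<in> borel_measurable m"
  shows "lp_osc p r (\<lambda>x. c * f x) = ennreal (\<bar>c\<bar> powr p) * lp_osc p r f"
proof -
  have "ennreal (\<bar>c * f x - c * f y\<bar> powr p) = ennreal (\<bar>c\<bar> powr p) * ennreal (\<bar>f x - f y\<bar> powr p)" for x y
    by (simp add: abs_mult powr_mult flip: right_diff_distrib ennreal_mult)
  then have "lp_osc p r (\<lambda>x. c * f x) =
      (\<integral>\<^sup>+ x. ennreal (\<bar>c\<bar> powr p) * ball_avg r (\<lambda>y. ennreal (\<bar>f x - f y\<bar> powr p)) x \<partial>m)"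
    unfolding lp_osc_def by (simp add: ball_avg_cmult)
  also have "\<dots> = ennreal (\<bar>c\<bar> powr p) * lp_osc p r f"
    unfolding lp_osc_def by (rule nn_integral_cmult) measurable
  finally show ?thesis .
qed

lemma lp_osc_add_le:
  assumes [measurable]: "f \<in> borel_measurable m" "g \<in> borel_measurable m" and "0 \<le> p"
  shows "lp_osc p r (\<lambda>x. f x + g x) \<le> ennreal (2 powr p) * (lp_osc p r f + lp_osc p r g)"
proof -
  have "ennreal (\<bar>(f x + g x) - (f y + g y)\<bar> powr p) \<le>
      ennreal (2 powr p) * (ennreal (\<bar>f x - f y\<bar> powr p) + ennreal (\<bar>g x - g y\<bar> powr p))" for x y
    using abs_powr_add_le[OF \<open>0 \<le> p\<close>, of "f x - f y" "g x - g y"]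
    by (auto simp: algebra_simps simp flip: ennreal_plus ennreal_mult intro!: ennreal_leI)
  then have "lp_osc p r (\<lambda>x. f x + g x) \<le> (\<integral>\<^sup>+ x. ball_avg r (\<lambda>y. ennreal (2 powr p) *
      (ennreal (\<bar>f x - f y\<bar> powr p) + ennreal (\<bar>g x - g y\<bar> powr p))) x \<partial>m)"
    unfolding lp_osc_def by (intro nn_integral_mono ball_avg_mono)
  also have "\<dots> = ennreal (2 powr p) * (lp_osc p r f + lp_osc p r g)"
    unfolding lp_osc_def
    by (simp add: ball_avg_cmult ball_avg_add nn_integral_cmult nn_integral_add)
  finally show ?thesis .
qed

text \<open>The constant does not depend on r. This makes vanishing of the oscillation stable under
  L_p limits, and it also settles the coarsest scale of the final sum.\<close>

lemma lp_osc_le_Lp: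
  assumes [measurable]: "f \<in> borel_measurable m" and "0 \<le> p" and r: "0 < r" "r \<le> 1/2"
  shows "lp_osc p r f \<le> ennreal (2 powr p * (1 + D)) * (\<integral>\<^sup>+ x. ennreal (\<bar>f x\<bar> powr p) \<partial>m)"
proof -
  have "ennreal (\<bar>f x - f y\<bar> powr p) \<le>
      ennreal (2 powr p) * (ennreal (\<bar>f x\<bar> powr p) + ennreal (\<bar>f y\<bar> powr p))" for x y
    using abs_powr_add_le[OF \<open>0 \<le> p\<close>, of "f x" "- f y"]
    by (auto simp flip: ennreal_plus ennreal_mult intro!: ennreal_leI)
  then have "lp_osc p r f \<le> (\<integral>\<^sup>+ x. ball_avg r (\<lambda>y. ennreal (2 powr p) *
      (ennreal (\<bar>f x\<bar> powr p) + ennreal (\<bar>f y\<bar> powr p))) x \<partial>m)"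
    unfolding lp_osc_def by (intro nn_integral_mono ball_avg_mono)
  also have "\<dots> = ennreal (2 powr p) * ((\<integral>\<^sup>+ x. ball_avg r (\<lambda>y. ennreal (\<bar>f x\<bar> powr p)) x \<partial>m)
      + (\<integral>\<^sup>+ x. ball_avg r (\<lambda>y. ennreal (\<bar>f y\<bar> powr p)) x \<partial>m))"
    by (simp add: ball_avg_cmult ball_avg_add nn_integral_cmult nn_integral_add)
  also have "(\<integral>\<^sup>+ x. ball_avg r (\<lambda>y. ennreal (\<bar>f x\<bar> powr p)) x \<partial>m) = (\<integral>\<^sup>+ x. ennreal (\<bar>f x\<bar> powr p) \<partial>m)"
    using AE_S r by (intro nn_integral_cong_AE) (auto elim!: eventually_mono simp: ball_avg_const)
  also have "(\<integral>\<^sup>+ x. ball_avg r (\<lambda>y. ennreal (\<bar>f y\<bar> powr p)) x \<partial>m) \<le>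
      ennreal D * (\<integral>\<^sup>+ x. ennreal (\<bar>f x\<bar> powr p) \<partial>m)"
    using r by (intro nn_integral_ball_avg_le) auto
  also have "ennreal (2 powr p) * ((\<integral>\<^sup>+ x. ennreal (\<bar>f x\<bar> powr p) \<partial>m) +
      ennreal D * (\<integral>\<^sup>+ x. ennreal (\<bar>f x\<bar> powr p) \<partial>m)) =
      ennreal (2 powr p * (1 + D)) * (\<integral>\<^sup>+ x. ennreal (\<bar>f x\<bar> powr p) \<partial>m)"
    using D_ge_1 by (simp add: ennreal_mult distrib_right distrib_left mult.assoc)
  finally show ?thesis
    by (simp add: add_left_mono mult_left_mono)
qed

text \<open>Outer regularity is applied to the finite restrictions of m to the sets
  \<open>W i\<close>, with errors e / 2^(i+1), and the pieces \<open>W i \<inter> U i\<close> are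
  glued. Since the \<open>W i\<close> cover only S, the open set contains only the part of A in
  S.\<close>

lemma open_approximation:
  assumes A: "A \<in> sets m" and e: "0 < (e::real)"
  obtains U where "open U" "A \<inter> S \<subseteq> U" "emeasure m (U - A) \<le> ennreal e"
proof -
  obtain W :: "nat \<Rightarrow> 'a set" where W: "\<And>i. open (W i)" "\<And>i. emeasure m (W i) < top" "S \<subseteq> (\<Union>i. W i)"
    using countable_open_cover by blast
  have [measurable]: "W i \<in> sets m" "A \<in> sets m" for i
    using W(1) A by (auto simp: sets_m)
  have "\<exists>U. open U \<and> A \<subseteq> U \<and> emeasure m (W i \<inter> U - A) \<le> ennreal (e * (1/2) ^ Suc i)" for i
  proof -
    define M where "M = density m (indicator (W i))"
    have sM: "sets M = sets borel" by (simp add: M_def sets_m)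
    have eM: "emeasure M B = emeasure m (W i \<inter> B)" if "B \<in> sets m" for B
      using that by (simp add: M_def emeasure_density indicator_inter_arith[symmetric])
    have "space M = UNIV" by (simp add: M_def)
    then have fin: "emeasure M (space M) \<noteq> \<infinity>"
      using W(2)[of i] eM[of UNIV] sets.top[of m] by simp
    have finA: "emeasure M A < top"
      unfolding eM[OF A] using emeasure_mono[of "W i \<inter> A" "W i" m] W(2)[of i] by (auto intro: le_less_trans)
    \<comment> \<open>Strict because the mass of A in \<open>W i\<close> is finite; finiteness is
      also what allows it to be cancelled below.\<close>
    have "emeasure M A < emeasure M A + ennreal (e * (1/2) ^ Suc i)"
      using finA e by simp
    then have "(INF U\<in>{U. A \<subseteq> U \<and> open U}. emeasure M U) < emeasure M A + ennreal (e * (1/2) ^ Suc i)"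
      using outer_regular[OF sM fin, of A] A by (simp add: sets_m)
    then obtain U where U: "A \<subseteq> U" "open U" "emeasure M U < emeasure M A + ennreal (e * (1/2) ^ Suc i)"
      unfolding INF_less_iff by auto
    have [measurable]: "U \<in> sets m" using U by (simp add: sets_m)
    have "emeasure m (W i \<inter> A) + emeasure m (W i \<inter> U - A) = emeasure m (W i \<inter> U)"
      using U(1) by (subst plus_emeasure) (auto intro!: arg_cong[where f="emeasure m"])
    with U(3) finA have "emeasure m (W i \<inter> A) + emeasure m (W i \<inter> U - A) \<le> emeasure m (W i \<inter> A) + ennreal (e * (1/2) ^ Suc i)"
      by (simp add: eM)
    then have "emeasure m (W i \<inter> U - A) \<le> ennreal (e * (1/2) ^ Suc i)"
      using finA by (subst (asm) ennreal_add_left_cancel_le) (auto simp: eM)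
    with U show ?thesis by blast
  qed
  then obtain U where U: "\<And>i. open (U i)" "\<And>i. A \<subseteq> U i"
    "\<And>i. emeasure m (W i \<inter> U i - A) \<le> ennreal (e * (1/2) ^ Suc i)"
    by metis
  have [measurable]: "U i \<in> sets m" for i using U by (simp add: sets_m)
  have "emeasure m ((\<Union>i. W i \<inter> U i) - A) = emeasure m (\<Union>i. W i \<inter> U i - A)"
    by (intro arg_cong[where f="emeasure m"]) auto
  also have "\<dots> \<le> (\<Sum>i. emeasure m (W i \<inter> U i - A))"
    by (intro emeasure_subadditive_countably) auto
  also have "\<dots> \<le> (\<Sum>i. ennreal (e * (1/2) ^ Suc i))"
    using U by (intro suminf_le) auto
  also have "\<dots> = ennreal (e * 1)"
    using e by (intro suminf_ennreal_eq sums_mult power_half_series) auto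
  finally have "emeasure m ((\<Union>i. W i \<inter> U i) - A) \<le> ennreal e" by simp
  moreover have "A \<inter> S \<subseteq> (\<Union>i. W i \<inter> U i)"
  proof
    fix x assume x: "x \<in> A \<inter> S"
    then obtain i where "x \<in> W i" using W(3) by auto
    with U(2)[of i] x show "x \<in> (\<Union>i. W i \<inter> U i)" by auto
  qed
  ultimately show ?thesis
    using U(1) W(1) by (intro that[of "\<Union>i. W i \<inter> U i"] open_UN ballI open_Int)
qed

section \<open>Vanishing of the oscillation along radii tending to 0\<close>

context
  fixes p :: real and r :: "nat \<Rightarrow> real"
  assumes p: "0 < p" and r: "\<And>n. 0 < r n" "\<And>n. r n \<le> 1/2" "r \<longlonglongrightarrow> 0"
begin

lemma lp_osc_add_tendsto_0:
  assumes [measurable]: "f \<in> borel_measurable m" "g \<in> borel_measurable m"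
    and "(\<lambda>n. lp_osc p (r n) f) \<longlonglongrightarrow> 0" "(\<lambda>n. lp_osc p (r n) g) \<longlonglongrightarrow> 0"
  shows "(\<lambda>n. lp_osc p (r n) (\<lambda>x. f x + g x)) \<longlonglongrightarrow> 0"
proof (rule tendsto_sandwich[OF _ _ tendsto_const])
  have "(\<lambda>n. ennreal (2 powr p) * (lp_osc p (r n) f + lp_osc p (r n) g)) \<longlonglongrightarrow> ennreal (2 powr p) * (0 + 0)"
    using assms by (intro ennreal_tendsto_cmult tendsto_add) auto
  then show "(\<lambda>n. ennreal (2 powr p) * (lp_osc p (r n) f + lp_osc p (r n) g)) \<longlonglongrightarrow> 0" by simp
  show "\<forall>\<^sub>F n in sequentially. lp_osc p (r n) (\<lambda>x. f x + g x) \<le> ennreal (2 powr p) * (lp_osc p (r n) f + lp_osc p (r n) g)"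
    using p by (intro always_eventually allI lp_osc_add_le) auto
qed simp

text \<open>Closedness in L_p: f - g contributes at most a constant times its L_p norm uniformly in
  n, and g contributes nothing in the limit.\<close>

lemma lp_osc_tendsto_0_approx:
  assumes f [measurable]: "f \<in> borel_measurable m"
    and approx: "\<And>e. 0 < e \<Longrightarrow> \<exists>g\<in>borel_measurable m.
          (\<integral>\<^sup>+ x. ennreal (\<bar>f x - g x\<bar> powr p) \<partial>m) \<le> ennreal e \<and> (\<lambda>n. lp_osc p (r n) g) \<longlonglongrightarrow> 0"
  shows "(\<lambda>n. lp_osc p (r n) f) \<longlonglongrightarrow> 0"
proof (rule tendsto_0_ennrealI)
  fix e :: real assume e: "0 < e"
  define c where "c = 2 powr p"
  define K where "K = 2 powr p * (1 + D)"
  have c: "0 < c" "0 < K" using D_ge_1 by (auto simp: c_def K_def)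
  \<comment> \<open>The tolerance is chosen so that each of the two contributions, after
    multiplication by c, is at most e / 2.\<close>
  obtain g where g [measurable]: "g \<in> borel_measurable m"
    and fg: "(\<integral>\<^sup>+ x. ennreal (\<bar>f x - g x\<bar> powr p) \<partial>m) \<le> ennreal (e / (2 * c * K))"
    and lim: "(\<lambda>n. lp_osc p (r n) g) \<longlonglongrightarrow> 0"
    using approx[of "e / (2 * c * K)"] e c by auto
  have "eventually (\<lambda>n. lp_osc p (r n) g < ennreal (e / (2 * c))) sequentially"
    using order_tendstoD(2)[OF lim, of "ennreal (e / (2 * c))"] e c by simp
  then show "eventually (\<lambda>n. lp_osc p (r n) f \<le> ennreal e) sequentially"
  proof eventually_elim
    case (elim n)
    have "lp_osc p (r n) f \<le> ennreal c * (lp_osc p (r n) (\<lambda>x. f x - g x) + lp_osc p (r n) g)"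
      unfolding c_def using lp_osc_add_le[of "\<lambda>x. f x - g x" g p "r n"] p by simp
    also have "\<dots> \<le> ennreal c * (ennreal K * ennreal (e / (2 * c * K)) + ennreal (e / (2 * c)))"
    proof (intro mult_left_mono add_mono)
      have "lp_osc p (r n) (\<lambda>x. f x - g x) \<le> ennreal K * (\<integral>\<^sup>+ x. ennreal (\<bar>f x - g x\<bar> powr p) \<partial>m)"
        unfolding K_def using p r by (intro lp_osc_le_Lp) auto
      also have "\<dots> \<le> ennreal K * ennreal (e / (2 * c * K))"
        by (intro mult_left_mono fg) auto
      finally show "lp_osc p (r n) (\<lambda>x. f x - g x) \<le> ennreal K * ennreal (e / (2 * c * K))" .
    qed (use elim in auto)
    also have "\<dots> = ennreal e"
      using e c by (simp flip: ennreal_mult ennreal_plus)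
    finally show ?case .
  qed
qed

text \<open>The part of the oscillation with \<open>x \<in> U\<close> tends to \<open>0\<close> because the balls around \<open>x\<close> end up
  inside \<open>U\<close>; the part with \<open>x \<notin> U\<close> is bounded by the former by symmetry.\<close>

lemma lp_osc_indicator_open_tendsto_0:
  assumes U: "open U" "emeasure m U < top"
  shows "(\<lambda>n. lp_osc p (r n) (indicator U)) \<longlonglongrightarrow> 0"
proof -
  have [measurable]: "U \<in> sets m" using U by (simp add: sets_m)
  define I where "I = (\<lambda>n. \<integral>\<^sup>+ x. ball_avg (r n) (\<lambda>y. indicator U x * indicator (- U) y) x \<partial>m)"
  have "I \<longlonglongrightarrow> (\<integral>\<^sup>+ x. 0 \<partial>m)"
    unfolding I_def
  proof (rule nn_integral_dominated_convergence[where w = "indicator U"])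
    show "(\<integral>\<^sup>+ x. indicator U x \<partial>m) < \<infinity>" using U by simp
    show "AE x in m. ball_avg (r n) (\<lambda>y. indicator U x * indicator (- U) y) x \<le> indicator U x" for n
      using AE_S
    proof eventually_elim
      case (elim x)
      have "ball_avg (r n) (\<lambda>y. indicator U x * indicator (- U) y) x \<le> ball_avg (r n) (\<lambda>y. indicator U x) x"
        by (intro ball_avg_mono) (auto simp: indicator_def)
      also have "\<dots> = indicator U x"
        using elim r(1)[of n] r(2)[of n] by (intro ball_avg_const) auto
      finally show ?case .
    qed
    show "AE x in m. (\<lambda>n. ball_avg (r n) (\<lambda>y. indicator U x * indicator (- U) y) x) \<longlonglongrightarrow> 0"
    proof (rule AE_I2)
      fix x
      have "eventually (\<lambda>n. ball_avg (r n) (\<lambda>y. indicator U x * indicator (- U) y) x = 0) sequentially"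
      proof (cases "x \<in> U")
        case True
        then obtain d where d: "0 < d" "cball x d \<subseteq> U"
          using U(1) open_contains_cball by blast
        have "eventually (\<lambda>n. r n < d) sequentially"
          using order_tendstoD(2)[OF r(3) d(1)] .
        then show ?thesis
        proof eventually_elim
          case (elim n)
          then have "cball x (r n) \<subseteq> U" using d by (meson order_trans less_imp_le subset_cball)
          then have zero: "indicator U x * indicator (- U) y * indicator (cball x (r n)) y = (0::ennreal)" for y
            by (auto simp: indicator_def)
          show ?case by (simp only: ball_avg_def zero) simp
        qed
      qed (simp add: ball_avg_def)
      then show "(\<lambda>n. ball_avg (r n) (\<lambda>y. indicator U x * indicator (- U) y) x) \<longlonglongrightarrow> 0"
        by (rule tendsto_eventually)
    qed
  qed measurable
  then have I: "I \<longlonglongrightarrow> 0" by simp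
  have le: "lp_osc p (r n) (indicator U) \<le> ennreal (1 + D) * I n" for n
  proof -
    have eq: "ennreal (\<bar>indicator U x - indicator U y\<bar> powr p) =
        indicator U x * indicator (- U) y + indicator (- U) x * indicator U y" for x y
      using p by (auto simp: indicator_def)
    have "lp_osc p (r n) (indicator U) =
        I n + (\<integral>\<^sup>+ x. ball_avg (r n) (\<lambda>y. indicator (- U) x * indicator U y) x \<partial>m)"
      unfolding lp_osc_def eq I_def by (simp add: ball_avg_add nn_integral_add)
    also have "(\<integral>\<^sup>+ x. ball_avg (r n) (\<lambda>y. indicator (- U) x * indicator U y) x \<partial>m) \<le>
       ennreal D * (\<integral>\<^sup>+ y. ball_avg (r n) (\<lambda>x. indicator (- U) x * indicator U y) y \<partial>m)"
      using r by (intro nn_integral_ball_avg_swap_le[of "\<lambda>x y. indicator (- U) x * indicator U y"]) auto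
    also have "(\<integral>\<^sup>+ y. ball_avg (r n) (\<lambda>x. indicator (- U) x * indicator U y) y \<partial>m) = I n"
      unfolding I_def by (simp add: mult.commute)
    also have "I n + ennreal D * I n = ennreal (1 + D) * I n"
      using D_ge_1 by (simp add: distrib_right)
    finally show ?thesis by (simp add: add_left_mono)
  qed
  have "(\<lambda>n. ennreal (1 + D) * I n) \<longlonglongrightarrow> ennreal (1 + D) * 0"
    by (intro ennreal_tendsto_cmult I) auto
  then have lim: "(\<lambda>n. ennreal (1 + D) * I n) \<longlonglongrightarrow> 0" by simp
  show ?thesis
    by (rule tendsto_sandwich[OF _ _ tendsto_const lim]) (simp_all add: le)
qed

lemma lp_osc_indicator_tendsto_0:
  assumes A [measurable]: "A \<in> sets m" and fin: "emeasure m A < top"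
  shows "(\<lambda>n. lp_osc p (r n) (indicator A)) \<longlonglongrightarrow> 0"
proof (rule lp_osc_tendsto_0_approx)
  fix e :: real assume e: "0 < e"
  obtain U where U: "open U" "A \<inter> S \<subseteq> U" "emeasure m (U - A) \<le> ennreal e"
    using open_approximation[OF A e] by blast
  have [measurable]: "U \<in> sets m" using U by (simp add: sets_m)
  have "emeasure m U \<le> emeasure m (A \<union> (U - A))"
    by (intro emeasure_mono) auto
  also have "\<dots> \<le> emeasure m A + emeasure m (U - A)"
    by (intro emeasure_subadditive) auto
  also have "\<dots> < top"
    using fin U(3) by (auto simp: less_top[symmetric] top_unique)
  finally have Ufin: "emeasure m U < top" .
  \<comment> \<open>The set A - U misses S and is null, so almost everywhere the difference is
    carried by U - A.\<close>
  have "(\<integral>\<^sup>+ x. ennreal (\<bar>indicator A x - indicator U x\<bar> powr p) \<partial>m) = (\<integral>\<^sup>+ x. indicator (U - A) x \<partial>m)"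
    using AE_S by (intro nn_integral_cong_AE) (use U(2) p in \<open>auto elim!: eventually_mono simp: indicator_def\<close>)
  also have "\<dots> \<le> ennreal e"
    using U(3) by simp
  finally show "\<exists>g\<in>borel_measurable m. (\<integral>\<^sup>+ x. ennreal (\<bar>indicator A x - g x\<bar> powr p) \<partial>m) \<le> ennreal e \<and>
      (\<lambda>n. lp_osc p (r n) g) \<longlonglongrightarrow> 0"
    using lp_osc_indicator_open_tendsto_0[OF U(1) Ufin] by (intro bexI[of _ "indicator U"]) auto
qed simp

text \<open>The finite L_p norm takes part in the induction, so each case first derives it for the
  smaller functions, using u, v <= u + v in sums and \<open>U i <= f\<close> in monotone
  limits.\<close>

lemma lp_osc_tendsto_0_nonneg:
  assumes f: "f \<in> borel_measurable m" "\<And>x. 0 \<le> f x"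
    and fin: "(\<integral>\<^sup>+ x. ennreal (f x powr p) \<partial>m) < top"
  shows "(\<lambda>n. lp_osc p (r n) f) \<longlonglongrightarrow> 0"
  using f fin
proof (induction rule: borel_measurable_induct_real)
  case (set A)
  have "(\<lambda>x. ennreal (indicator A x powr p)) = indicator A"
    using p by (auto simp: indicator_def)
  with set show ?case
    by (intro lp_osc_indicator_tendsto_0) auto
next
  case (mult u c)
  show ?case
  \<comment> \<open>When c = 0, finiteness of the norm of c u says nothing about u, and the
    induction hypothesis is out of reach.\<close>
  proof (cases "c = 0")
    case True
    then show ?thesis using p by (simp add: lp_osc_def ball_avg_def)
  next
    case False
    note [measurable] = mult.hyps(2)
    have "(\<integral>\<^sup>+ x. ennreal ((c * u x) powr p) \<partial>m) = ennreal (c powr p) * (\<integral>\<^sup>+ x. ennreal (u x powr p) \<partial>m)"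
      using mult.hyps by (subst nn_integral_cmult[symmetric]) (auto simp: powr_mult ennreal_mult)
    with mult.prems False mult.hyps have "(\<integral>\<^sup>+ x. ennreal (u x powr p) \<partial>m) < top"
      by (auto simp: ennreal_mult_less_top)
    then have "(\<lambda>n. ennreal (\<bar>c\<bar> powr p) * lp_osc p (r n) u) \<longlonglongrightarrow> ennreal (\<bar>c\<bar> powr p) * 0"
      using mult.IH by (intro ennreal_tendsto_cmult) auto
    then show ?thesis by (simp add: lp_osc_cmult)
  qed
next
  case (add u v)
  have "(\<integral>\<^sup>+ x. ennreal (u x powr p) \<partial>m) < top" "(\<integral>\<^sup>+ x. ennreal (v x powr p) \<partial>m) < top"
    using add.hyps p
    by (auto intro!: le_less_trans[OF nn_integral_mono add.prems] ennreal_leI powr_mono2)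
  with add show ?case
    by (intro lp_osc_add_tendsto_0) auto
next
  case (seq U)
  note [measurable] = seq.hyps(1) f(1)
  have Uf: "U i x \<le> f x" for i x
    using seq.hyps by (intro incseq_le) (auto simp: incseq_def le_fun_def)
  show ?case
  proof (rule lp_osc_tendsto_0_approx)
    fix e :: real assume e: "0 < e"
    have "(\<lambda>i. \<integral>\<^sup>+ x. ennreal (\<bar>f x - U i x\<bar> powr p) \<partial>m) \<longlonglongrightarrow> (\<integral>\<^sup>+ x. 0 \<partial>m)"
    proof (rule nn_integral_dominated_convergence[where w = "\<lambda>x. ennreal (f x powr p)"])
      show "AE x in m. (\<lambda>i. ennreal (\<bar>f x - U i x\<bar> powr p)) \<longlonglongrightarrow> 0"
      proof (rule AE_I2)
        fix x
        have "(\<lambda>i. \<bar>f x - U i x\<bar>) \<longlonglongrightarrow> \<bar>f x - f x\<bar>"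
          using seq.hyps by (intro tendsto_intros) auto
        then have "(\<lambda>i. \<bar>f x - U i x\<bar> powr p) \<longlonglongrightarrow> 0 powr p"
          using p by (intro tendsto_powr') auto
        then show "(\<lambda>i. ennreal (\<bar>f x - U i x\<bar> powr p)) \<longlonglongrightarrow> 0"
          using tendsto_ennrealI by fastforce
      qed
    qed (use seq.prems seq.hyps(2) Uf p in \<open>auto intro!: ennreal_leI powr_mono2\<close>)
    then have "eventually (\<lambda>i. (\<integral>\<^sup>+ x. ennreal (\<bar>f x - U i x\<bar> powr p) \<partial>m) < ennreal e) sequentially"
      using e by (intro order_tendstoD(2)) auto
    then obtain i where i: "(\<integral>\<^sup>+ x. ennreal (\<bar>f x - U i x\<bar> powr p) \<partial>m) < ennreal e"
      unfolding eventually_sequentially by blast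
    have "(\<integral>\<^sup>+ x. ennreal (U i x powr p) \<partial>m) < top"
      using seq.hyps(2) Uf p
      by (auto intro!: le_less_trans[OF nn_integral_mono seq.prems] ennreal_leI powr_mono2)
    with i seq.IH show "\<exists>g\<in>borel_measurable m. (\<integral>\<^sup>+ x. ennreal (\<bar>f x - g x\<bar> powr p) \<partial>m) \<le> ennreal e \<and>
      (\<lambda>n. lp_osc p (r n) g) \<longlonglongrightarrow> 0"
      by (intro bexI[of _ "U i"]) auto
  qed simp
qed

lemma lp_osc_tendsto_0:
  assumes [measurable]: "f \<in> borel_measurable m"
    and fin: "(\<integral>\<^sup>+ x. ennreal (\<bar>f x\<bar> powr p) \<partial>m) < top"
  shows "(\<lambda>n. lp_osc p (r n) f) \<longlonglongrightarrow> 0"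
proof -
  have pos: "(\<lambda>n. lp_osc p (r n) (\<lambda>x. max 0 (f x))) \<longlonglongrightarrow> 0"
    and neg: "(\<lambda>n. lp_osc p (r n) (\<lambda>x. max 0 (- f x))) \<longlonglongrightarrow> 0"
    using p by (auto intro!: lp_osc_tendsto_0_nonneg le_less_trans[OF nn_integral_mono fin] ennreal_leI powr_mono2)
  have "(\<lambda>n. lp_osc p (r n) (\<lambda>x. (-1) * max 0 (- f x))) \<longlonglongrightarrow> 0"
    using neg by (subst lp_osc_cmult) auto
  then have "(\<lambda>n. lp_osc p (r n) (\<lambda>x. max 0 (f x) + (-1) * max 0 (- f x))) \<longlonglongrightarrow> 0"
    by (intro lp_osc_add_tendsto_0 pos) auto
  also have "(\<lambda>x. max 0 (f x) + (-1) * max 0 (- f x)) = f"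
    by (auto simp: max_def)
  finally show ?thesis .
qed

end

end

section \<open>Mean oscillation and ball means\<close>

lemma suminf_swap_ennreal: "(\<Sum>i. \<Sum>j. f i j) = (\<Sum>j. \<Sum>i. f i j :: ennreal)"
  for f :: "nat \<Rightarrow> nat \<Rightarrow> ennreal"
proof -
  have "(\<Sum>j. \<Sum>i. f i j) = (\<integral>\<^sup>+ j. (\<Sum>i. f i j) \<partial>count_space UNIV)"
    by (rule nn_integral_count_space_nat[symmetric])
  also have "\<dots> = (\<Sum>i. \<integral>\<^sup>+ j. f i j \<partial>count_space UNIV)"
    by (rule nn_integral_suminf) simp
  finally show ?thesis
    by (simp add: nn_integral_count_space_nat)
qed

text \<open>The discrete Hardy inequality. After exchanging the sums, the weights with k <= j form a
  geometric sum dominated by its last term Q^j, which doubles the exponent of the weight of e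
  j.\<close>

lemma geometric_tail_sum_le:
  fixes e :: "nat \<Rightarrow> ennreal" and Q :: real
  assumes Q: "1 < Q"
  shows "(\<Sum>k. ennreal (Q ^ k) * (\<Sum>j. if k \<le> j then ennreal (Q ^ j) * e j else 0)) \<le>
           ennreal (Q / (Q - 1)) * (\<Sum>j. ennreal (Q ^ (2 * j)) * e j)"
proof -
  have "(\<Sum>k. ennreal (Q ^ k) * (\<Sum>j. if k \<le> j then ennreal (Q ^ j) * e j else 0)) =
      (\<Sum>k. \<Sum>j. if k \<le> j then ennreal (Q ^ k) * (ennreal (Q ^ j) * e j) else 0)"
    by (subst ennreal_suminf_cmult[symmetric]) (intro suminf_cong, simp)
  also have "\<dots> = (\<Sum>j. \<Sum>k. if k \<le> j then ennreal (Q ^ k) * (ennreal (Q ^ j) * e j) else 0)"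
    by (rule suminf_swap_ennreal)
  also have "\<dots> \<le> (\<Sum>j. ennreal (Q / (Q - 1)) * (ennreal (Q ^ (2 * j)) * e j))"
  proof (intro suminf_le summableI)
    fix j
    have "(\<Sum>k. if k \<le> j then ennreal (Q ^ k) * (ennreal (Q ^ j) * e j) else 0) =
        (\<Sum>k\<le>j. ennreal (Q ^ k) * (ennreal (Q ^ j) * e j))"
      by (subst suminf_finite[of "{..j}"]) auto
    also have "\<dots> = ennreal (\<Sum>k\<le>j. Q ^ k) * (ennreal (Q ^ j) * e j)"
      using Q by (simp add: sum_distrib_right[symmetric] sum_ennreal)
    also have "(\<Sum>k\<le>j. Q ^ k) \<le> Q / (Q - 1) * Q ^ j"
    proof -
      have "(\<Sum>k\<le>j. Q ^ k) = (Q ^ Suc j - 1) / (Q - 1)"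
        using geometric_sum[of Q "Suc j"] Q by (simp add: lessThan_Suc_atMost)
      also have "\<dots> \<le> Q ^ Suc j / (Q - 1)"
        using Q by (intro divide_right_mono) auto
      finally show ?thesis by simp
    qed
    also have "ennreal (Q / (Q - 1) * Q ^ j) * (ennreal (Q ^ j) * e j) =
        ennreal (Q / (Q - 1)) * (ennreal (Q ^ (2 * j)) * e j)"
      unfolding mult.assoc[symmetric] using Q
      by (subst (1 2) ennreal_mult[symmetric]) (auto simp: power_add mult_2 mult.assoc)
    finally show "(\<Sum>k. if k \<le> j then ennreal (Q ^ k) * (ennreal (Q ^ j) * e j) else 0) \<le>
        ennreal (Q / (Q - 1)) * (ennreal (Q ^ (2 * j)) * e j)"
      by (simp add: ennreal_leI mult_right_mono)
  qed
  also have "\<dots> = ennreal (Q / (Q - 1)) * (\<Sum>j. ennreal (Q ^ (2 * j)) * e j)"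
    by (rule ennreal_suminf_cmult)
  finally show ?thesis .
qed

definition dyadic :: "nat \<Rightarrow> real" where
  "dyadic k = 2 powr (- real k)"

lemma dyadic_eq: "dyadic k = (1/2) ^ k"
  by (simp add: dyadic_def powr_minus powr_realpow power_one_over inverse_eq_divide)

lemma dyadic_pos [simp]: "0 < dyadic k"
  by (simp add: dyadic_eq)

lemma dyadic_le_1 [simp]: "dyadic k \<le> 1"
  by (simp add: dyadic_eq power_le_one)

lemma dyadic_Suc: "2 * dyadic (Suc k) = dyadic k"
  by (simp add: dyadic_eq)

lemma dyadic_Suc_le_half: "dyadic (Suc k) \<le> 1/2"
  by (simp add: dyadic_eq power_le_one)

lemma dyadic_tendsto_0: "dyadic \<longlonglongrightarrow> 0"
  by (simp add: dyadic_eq[abs_def] LIMSEQ_power_zero)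

section \<open>Comparison of ball means with the mean oscillation\<close>

context doubling_on
begin

text \<open>A Bochner integral, because f may change sign; \<open>integrable_on_ball\<close> makes
  it meaningful at centres in S.\<close>

definition ball_mean :: "real \<Rightarrow> ('a \<Rightarrow> real) \<Rightarrow> 'a \<Rightarrow> real" where
  "ball_mean r f x = (\<integral> y. f y * indicator (cball x r) y \<partial>m) / measure m (cball x r)"

lemma measurable_ball_mean [measurable]:
  assumes [measurable]: "f \<in> borel_measurable m"
  shows "ball_mean r f \<in> borel_measurable m"
  unfolding ball_mean_def[abs_def] by measurable

lemma mean_osc_eq:
  assumes "x \<in> S" "0 < r" "r \<le> 1"
  shows "mean_osc m f (cball x r) = (INF c. ball_avg r (\<lambda>y. ennreal \<bar>f y - c\<bar>) x)"
  using ball_pos[OF assms] by (simp add: mean_osc_def ball_avg_def)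

context
  fixes f :: "'a \<Rightarrow> real" and p :: real
  assumes f [measurable]: "f \<in> borel_measurable m" and p: "1 < p"
    and fin: "(\<integral>\<^sup>+ x. ennreal (\<bar>f x\<bar> powr p) \<partial>m) < top"
begin

text \<open>On a ball of finite mass |f| is dominated by 1 + |f|^p.\<close>

lemma integrable_on_ball:
  assumes x: "x \<in> S" "0 < r" "r \<le> 1"
  shows "integrable m (\<lambda>y. f y * indicator (cball x r) y)"
proof (rule integrableI_bounded)
  have "ennreal (norm (f y * indicator (cball x r) y)) \<le> indicator (cball x r) y + ennreal (\<bar>f y\<bar> powr p)" for y
  proof -
    have "\<bar>f y\<bar> \<le> 1 + \<bar>f y\<bar> powr p"
    proof (cases "\<bar>f y\<bar> \<le> 1")
      case False
      then have "\<bar>f y\<bar> powr 1 \<le> \<bar>f y\<bar> powr p" using p by (intro powr_mono) auto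
      then show ?thesis using False by simp
    qed (simp add: add_increasing2)
    then have "ennreal \<bar>f y\<bar> \<le> ennreal (1 + \<bar>f y\<bar> powr p)" by (rule ennreal_leI)
    then show ?thesis by (auto simp: indicator_def)
  qed
  then have "(\<integral>\<^sup>+ y. ennreal (norm (f y * indicator (cball x r) y)) \<partial>m) \<le>
      (\<integral>\<^sup>+ y. indicator (cball x r) y + ennreal (\<bar>f y\<bar> powr p) \<partial>m)"
    by (rule nn_integral_mono)
  also have "\<dots> = emeasure m (cball x r) + (\<integral>\<^sup>+ y. ennreal (\<bar>f y\<bar> powr p) \<partial>m)"
    by (subst nn_integral_add) auto
  also have "\<dots> < \<infinity>"
    using ball_finite[OF x] fin by simp
  finally show "(\<integral>\<^sup>+ y. ennreal (norm (f y * indicator (cball x r) y)) \<partial>m) < \<infinity>" .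
qed simp

text \<open>The integral of |f - c| only grows on the larger ball, and M pays for the change of
  normalisation. The constant c stays free: it is later the competitor in the infimum, or the value
  f(x).\<close>

lemma abs_ball_mean_diff_le:
  assumes z: "z \<in> S" "0 < \<rho>" "\<rho> \<le> 1" and x: "x \<in> S" "0 < r" "r \<le> 1"
    and sub: "cball z \<rho> \<subseteq> cball x r"
    and M: "0 \<le> M" "emeasure m (cball x r) \<le> ennreal M * emeasure m (cball z \<rho>)"
  shows "ennreal \<bar>ball_mean \<rho> f z - c\<bar> \<le> ennreal M * ball_avg r (\<lambda>y. ennreal \<bar>f y - c\<bar>) x"
proof -
  obtain a where a: "emeasure m (cball x r) = ennreal a" "0 < a"
    using ball_pos[OF x] ball_finite[OF x] by (cases "emeasure m (cball x r)") auto
  obtain b where b: "emeasure m (cball z \<rho>) = ennreal b" "0 < b"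
    using ball_pos[OF z] ball_finite[OF z] by (cases "emeasure m (cball z \<rho>)") auto
  have mb: "measure m (cball z \<rho>) = b" using b by (simp add: measure_def)
  have ab: "a \<le> M * b" using M a b by (simp flip: ennreal_mult)
  have int: "integrable m (\<lambda>y. c * indicator (cball z \<rho>) y)"
    using b by (intro integrable_mult_right integrable_real_indicator) auto
  have "ball_mean \<rho> f z - c = (\<integral> y. f y * indicator (cball z \<rho>) y - c * indicator (cball z \<rho>) y \<partial>m) / b"
    unfolding ball_mean_def mb using b int integrable_on_ball[OF z] mb
    by (subst Bochner_Integration.integral_diff) (auto simp: field_simps)
  then have "ennreal \<bar>ball_mean \<rho> f z - c\<bar> =
      ennreal (norm (\<integral> y. f y * indicator (cball z \<rho>) y - c * indicator (cball z \<rho>) y \<partial>m)) / ennreal b"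
    using b by (simp add: divide_ennreal)
  also have "\<dots> \<le> (\<integral>\<^sup>+ y. ennreal (norm (f y * indicator (cball z \<rho>) y - c * indicator (cball z \<rho>) y)) \<partial>m) / ennreal b"
    using int integrable_on_ball[OF z] by (intro divide_right_mono_ennreal integral_norm_bound_ennreal) auto
  also have "\<dots> \<le> (\<integral>\<^sup>+ y. ennreal \<bar>f y - c\<bar> * indicator (cball x r) y \<partial>m) / ennreal b"
    using sub by (intro divide_right_mono_ennreal nn_integral_mono) (auto simp: indicator_def)
  also have "\<dots> \<le> (\<integral>\<^sup>+ y. ennreal \<bar>f y - c\<bar> * indicator (cball x r) y \<partial>m) * (ennreal M * inverse (ennreal a))"
    unfolding divide_ennreal_def
  proof (intro mult_left_mono)
    have "inverse b \<le> M * inverse a" using ab a b by (simp add: field_simps)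
    then show "inverse (ennreal b) \<le> ennreal M * inverse (ennreal a)"
      using a b M by (simp add: inverse_ennreal ennreal_leI flip: ennreal_mult)
  qed simp
  also have "\<dots> = ennreal M * ball_avg r (\<lambda>y. ennreal \<bar>f y - c\<bar>) x"
    unfolding ball_avg_def a(1) divide_ennreal_def by (simp add: mult_ac)
  finally show ?thesis .
qed

text \<open>Both means are compared with the same c before the infimum is taken. The factor M + M'
  is divided out on the left, so that later no constant has to leave an integral of the mean
  oscillation.\<close>

lemma ball_mean_diff_powr_le_mean_osc:
  assumes x: "x \<in> S" "0 < r" "r \<le> 1"
    and z: "z \<in> S" "0 < \<rho>" "\<rho> \<le> 1" "cball z \<rho> \<subseteq> cball x r"
    and M: "0 < M" "emeasure m (cball x r) \<le> ennreal M * emeasure m (cball z \<rho>)"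
    and z': "z' \<in> S" "0 < \<rho>'" "\<rho>' \<le> 1" "cball z' \<rho>' \<subseteq> cball x r"
    and M': "0 < M'" "emeasure m (cball x r) \<le> ennreal M' * emeasure m (cball z' \<rho>')"
  shows "ennreal ((\<bar>ball_mean \<rho> f z - ball_mean \<rho>' f z'\<bar> / (M + M')) powr p) \<le>
           enn_powr (mean_osc m f (cball x r)) p"
proof -
  define d where "d = \<bar>ball_mean \<rho> f z - ball_mean \<rho>' f z'\<bar>"
  have "ennreal (d / (M + M')) \<le> mean_osc m f (cball x r)"
    unfolding mean_osc_eq[OF x]
  proof (rule INF_greatest)
    fix c
    define A where "A = ball_avg r (\<lambda>y. ennreal \<bar>f y - c\<bar>) x"
    have "ennreal d \<le> ennreal \<bar>ball_mean \<rho> f z - c\<bar> + ennreal \<bar>ball_mean \<rho>' f z' - c\<bar>"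
      unfolding d_def by (auto simp flip: ennreal_plus intro!: ennreal_leI)
    also have "\<dots> \<le> ennreal M * A + ennreal M' * A"
      unfolding A_def using assms by (intro add_mono abs_ball_mean_diff_le) auto
    also have "\<dots> = ennreal (M + M') * A"
      using M M' by (simp add: distrib_right)
    finally have dA: "ennreal d \<le> ennreal (M + M') * A" .
    show "ennreal (d / (M + M')) \<le> ball_avg r (\<lambda>y. ennreal \<bar>f y - c\<bar>) x"
      unfolding A_def[symmetric]
    proof (cases A)
      case (real t)
      with dA M M' have "d \<le> (M + M') * t"
        by (simp flip: ennreal_mult ennreal_plus)
      then show "ennreal (d / (M + M')) \<le> A"
        using real M M' by (auto intro!: ennreal_leI simp: field_simps)
    qed simp
  qed
  then have "enn_powr (ennreal (d / (M + M'))) p \<le> enn_powr (mean_osc m f (cball x r)) p"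
    using p by (intro enn_powr_mono) auto
  moreover have "0 \<le> d / (M + M')"
    using M M' by (simp add: d_def)
  ultimately show ?thesis by (simp add: d_def)
qed

definition mean_osc_int :: "real \<Rightarrow> ennreal" where
  "mean_osc_int r = (\<integral>\<^sup>+ x. enn_powr (mean_osc m f (cball x r)) p \<partial>m)"

lemma mean_osc_int_le_lp_osc:
  assumes r: "0 < r" "r \<le> 1"
  shows "mean_osc_int r \<le> ennreal (2 powr p) * lp_osc p r f"
proof -
  have "mean_osc_int r \<le> (\<integral>\<^sup>+ x. ennreal (2 powr p) * ball_avg r (\<lambda>y. ennreal (\<bar>f x - f y\<bar> powr p)) x \<partial>m)"
    unfolding mean_osc_int_def
  proof (rule nn_integral_mono_AE)
    show "AE x in m. enn_powr (mean_osc m f (cball x r)) p \<le>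
        ennreal (2 powr p) * ball_avg r (\<lambda>y. ennreal (\<bar>f x - f y\<bar> powr p)) x"
      using AE_S
    proof eventually_elim
      case (elim x)
      have "mean_osc m f (cball x r) \<le> ball_avg r (\<lambda>y. ennreal \<bar>f y - f x\<bar>) x"
        unfolding mean_osc_eq[OF elim r] by (rule INF_lower) simp
      then have "enn_powr (mean_osc m f (cball x r)) p \<le> enn_powr (ball_avg r (\<lambda>y. ennreal \<bar>f y - f x\<bar>) x) p"
        using p by (intro enn_powr_mono) auto
      also have "\<dots> \<le> ennreal (2 powr p) * ball_avg r (\<lambda>y. ennreal (\<bar>f y - f x\<bar> powr p)) x"
        using p elim r by (intro enn_powr_ball_avg_le) auto
      finally show ?case by (simp add: abs_minus_commute)
    qed
  qed
  also have "\<dots> = ennreal (2 powr p) * lp_osc p r f"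
    unfolding lp_osc_def by (rule nn_integral_cmult) measurable
  finally show ?thesis .
qed

definition mean_err :: "real \<Rightarrow> ennreal" where
  "mean_err r = (\<integral>\<^sup>+ x. ennreal (\<bar>f x - ball_mean r f x\<bar> powr p) \<partial>m)"

text \<open>The ball is compared with itself, with M = 1 and c = f(x), before the Jensen-type bound
  applies. Together with the decay of the oscillation it makes the means converge to f in
  L_p.\<close>

lemma mean_err_le_lp_osc:
  assumes r: "0 < r" "r \<le> 1"
  shows "mean_err r \<le> ennreal (2 powr p) * lp_osc p r f"
proof -
  have "mean_err r \<le> (\<integral>\<^sup>+ x. ennreal (2 powr p) * ball_avg r (\<lambda>y. ennreal (\<bar>f x - f y\<bar> powr p)) x \<partial>m)"
    unfolding mean_err_def
  proof (rule nn_integral_mono_AE)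
    show "AE x in m. ennreal (\<bar>f x - ball_mean r f x\<bar> powr p) \<le>
        ennreal (2 powr p) * ball_avg r (\<lambda>y. ennreal (\<bar>f x - f y\<bar> powr p)) x"
      using AE_S
    proof eventually_elim
      case (elim x)
      have "ennreal \<bar>f x - ball_mean r f x\<bar> \<le> ball_avg r (\<lambda>y. ennreal \<bar>f y - f x\<bar>) x"
        using abs_ball_mean_diff_le[of x r x r 1 "f x"] elim r by (simp add: abs_minus_commute)
      then have "enn_powr (ennreal \<bar>f x - ball_mean r f x\<bar>) p \<le> enn_powr (ball_avg r (\<lambda>y. ennreal \<bar>f y - f x\<bar>) x) p"
        using p by (intro enn_powr_mono) auto
      also have "\<dots> \<le> ennreal (2 powr p) * ball_avg r (\<lambda>y. ennreal (\<bar>f y - f x\<bar> powr p)) x"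
        using p elim r by (intro enn_powr_ball_avg_le) auto
      finally show ?case by (simp add: abs_minus_commute)
    qed
  qed
  also have "\<dots> = ennreal (2 powr p) * lp_osc p r f"
    unfolding lp_osc_def by (rule nn_integral_cmult) measurable
  finally show ?thesis .
qed

text \<open>In D + 1, the ball of radius r costs D inside the doubled ball, and the doubled ball
  itself costs 1.\<close>

lemma nn_integral_mean_step_le:
  assumes r: "0 < r" "r \<le> 1/2"
  shows "(\<integral>\<^sup>+ x. ennreal (\<bar>ball_mean r f x - ball_mean (2 * r) f x\<bar> powr p) \<partial>m) \<le>
           ennreal ((D + 1) powr p) * mean_osc_int (2 * r)"
proof -
  define d where "d = (\<lambda>x. \<bar>ball_mean r f x - ball_mean (2 * r) f x\<bar>)"
  have [measurable]: "d \<in> borel_measurable m" unfolding d_def by measurable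
  have "ennreal (d x powr p) = ennreal ((D + 1) powr p) * ennreal ((d x / (D + 1)) powr p)" for x
    using D_ge_1 by (simp add: d_def powr_divide flip: ennreal_mult)
  then have "(\<integral>\<^sup>+ x. ennreal (d x powr p) \<partial>m) =
      ennreal ((D + 1) powr p) * (\<integral>\<^sup>+ x. ennreal ((d x / (D + 1)) powr p) \<partial>m)"
    by (simp add: nn_integral_cmult)
  also have "\<dots> \<le> ennreal ((D + 1) powr p) * mean_osc_int (2 * r)"
    unfolding mean_osc_int_def
  proof (intro mult_left_mono nn_integral_mono_AE)
    show "AE x in m. ennreal ((d x / (D + 1)) powr p) \<le> enn_powr (mean_osc m f (cball x (2 * r))) p"
      using AE_S
    proof eventually_elim
      case (elim x)
      show ?case
        unfolding d_def using elim r D_ge_1 ball_doubling[of x r]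
        by (intro ball_mean_diff_powr_le_mean_osc) auto
    qed
  qed simp
  finally show ?thesis by (simp add: d_def)
qed

text \<open>Both balls of radius r lie in the ball of radius 2 r about x. The one about x costs D
  and the one about y costs D * D: halving about x first and then using
  \<open>cball x r \<subseteq> cball y (2 * r)\<close> keeps all radii at most 1.\<close>

lemma nn_integral_mean_shift_le:
  assumes r: "0 < r" "r \<le> 1/2"
  shows "(\<integral>\<^sup>+ x. ball_avg r (\<lambda>y. ennreal (\<bar>ball_mean r f x - ball_mean r f y\<bar> powr p)) x \<partial>m) \<le>
           ennreal ((D + D * D) powr p) * mean_osc_int (2 * r)"
proof -
  define d where "d = (\<lambda>x y. \<bar>ball_mean r f x - ball_mean r f y\<bar>)"
  define K where "K = D + D * D"
  have K: "0 < K" using D_ge_1 by (simp add: K_def add_pos_pos)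
  have [measurable]: "case_prod d \<in> borel_measurable (m \<Otimes>\<^sub>M m)" unfolding d_def by measurable
  have "ennreal (d x y powr p) = ennreal (K powr p) * ennreal ((d x y / K) powr p)" for x y
    using K by (simp add: d_def powr_divide flip: ennreal_mult)
  then have "(\<integral>\<^sup>+ x. ball_avg r (\<lambda>y. ennreal (d x y powr p)) x \<partial>m) =
      ennreal (K powr p) * (\<integral>\<^sup>+ x. ball_avg r (\<lambda>y. ennreal ((d x y / K) powr p)) x \<partial>m)"
    by (simp add: nn_integral_cmult ball_avg_cmult)
  also have "\<dots> \<le> ennreal (K powr p) * mean_osc_int (2 * r)"
    unfolding mean_osc_int_def
  proof (intro mult_left_mono nn_integral_mono_AE)
    show "AE x in m. ball_avg r (\<lambda>y. ennreal ((d x y / K) powr p)) x \<le> enn_powr (mean_osc m f (cball x (2 * r))) p"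
      using AE_S
    proof eventually_elim
      case (elim x)
      have "ball_avg r (\<lambda>y. ennreal ((d x y / K) powr p)) x \<le>
          ball_avg r (\<lambda>y. enn_powr (mean_osc m f (cball x (2 * r))) p) x"
      proof (rule ball_avg_mono)
        fix y assume y: "y \<in> S" "y \<in> cball x r"
        have "emeasure m (cball x (2 * r)) \<le> ennreal D * emeasure m (cball x r)"
          using elim r by (intro ball_doubling)
        also have "emeasure m (cball x r) \<le> emeasure m (cball y (2 * r))"
          using y by (intro emeasure_mono cball_subset_cball_of_dist) (auto simp: dist_commute)
        also have "\<dots> \<le> ennreal D * emeasure m (cball y r)"
          using y r by (intro ball_doubling)
        finally have "emeasure m (cball x (2 * r)) \<le> ennreal (D * D) * emeasure m (cball y r)"
          using D_ge_1 by (simp add: ennreal_mult mult.assoc mult_left_mono)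
        then show "ennreal ((d x y / K) powr p) \<le> enn_powr (mean_osc m f (cball x (2 * r))) p"
          unfolding d_def K_def using elim y r D_ge_1 ball_doubling[of x r]
          by (intro ball_mean_diff_powr_le_mean_osc cball_subset_cball_of_dist) auto
      qed
      also have "\<dots> = enn_powr (mean_osc m f (cball x (2 * r))) p"
        using elim r by (intro ball_avg_const) auto
      finally show ?case .
    qed
  qed simp
  finally show ?thesis by (simp add: d_def K_def)
qed

text \<open>The difference f(x) - f(y) is split at the means of radius r about x and about y. The
  error at x is constant in y, the error at y returns to \<open>mean_err\<close> through the L_1
  bound for averages, and the middle term is the shift of means.\<close>

lemma lp_osc_le_mean_err:
  assumes r: "0 < r" "r \<le> 1/2"
  shows "lp_osc p r f \<le> ennreal (4 powr p * (1 + D)) * mean_err r +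
           ennreal (4 powr p * (D + D * D) powr p) * mean_osc_int (2 * r)"
proof -
  define h where "h = (\<lambda>x. \<bar>f x - ball_mean r f x\<bar> powr p)"
  define d where "d = (\<lambda>x y. \<bar>ball_mean r f x - ball_mean r f y\<bar> powr p)"
  define c where "c = 4 powr p"
  have [measurable]: "h \<in> borel_measurable m" unfolding h_def by measurable
  have [measurable]: "case_prod d \<in> borel_measurable (m \<Otimes>\<^sub>M m)" unfolding d_def by measurable
  have "\<bar>f x - f y\<bar> powr p \<le> c * (h x + (d x y + h y))" for x y
  proof -
    have c: "c = 2 powr p * 2 powr p" unfolding c_def by (simp flip: powr_mult)
    have c1: "1 \<le> 2 powr p" using p by (simp add: ge_one_powr_ge_zero)
    have "\<bar>f x - f y\<bar> powr p \<le> 2 powr p * (h x + \<bar>ball_mean r f x - f y\<bar> powr p)"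
      using abs_powr_add_le[of p "f x - ball_mean r f x" "ball_mean r f x - f y"] p by (simp add: h_def)
    \<comment> \<open>The first term is enlarged by a further 2^p, so that all three share the
      factor 4^p.\<close>
    also have "\<dots> \<le> 2 powr p * (2 powr p * h x + 2 powr p * (d x y + h y))"
      using abs_powr_add_le[of p "ball_mean r f x - ball_mean r f y" "ball_mean r f y - f y"] p c1
      by (intro mult_left_mono add_mono) (auto simp: h_def d_def abs_minus_commute mult_le_cancel_right1 intro: mult_right_mono)
    also have "\<dots> = c * (h x + (d x y + h y))"
      by (simp add: c algebra_simps)
    finally show ?thesis .
  qed
  then have "ennreal (\<bar>f x - f y\<bar> powr p) \<le> ennreal c * (ennreal (h x) + (ennreal (d x y) + ennreal (h y)))" for x y
    by (simp add: h_def d_def c_def ennreal_leI flip: ennreal_plus ennreal_mult)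
  then have "lp_osc p r f \<le> (\<integral>\<^sup>+ x. ball_avg r (\<lambda>y. ennreal c * (ennreal (h x) + (ennreal (d x y) + ennreal (h y)))) x \<partial>m)"
    unfolding lp_osc_def by (intro nn_integral_mono ball_avg_mono)
  also have "\<dots> = ennreal c * ((\<integral>\<^sup>+ x. ball_avg r (\<lambda>y. ennreal (h x)) x \<partial>m) +
      ((\<integral>\<^sup>+ x. ball_avg r (\<lambda>y. ennreal (d x y)) x \<partial>m) + (\<integral>\<^sup>+ x. ball_avg r (\<lambda>y. ennreal (h y)) x \<partial>m)))"
    by (simp add: nn_integral_cmult nn_integral_add ball_avg_cmult ball_avg_add)
  also have "\<dots> \<le> ennreal c * (mean_err r + (ennreal ((D + D * D) powr p) * mean_osc_int (2 * r) + ennreal D * mean_err r))"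
  proof (intro mult_left_mono add_mono)
    show "(\<integral>\<^sup>+ x. ball_avg r (\<lambda>y. ennreal (h x)) x \<partial>m) \<le> mean_err r"
      unfolding mean_err_def using AE_S r
      by (intro nn_integral_mono_AE) (auto elim!: eventually_mono simp: ball_avg_const h_def)
    show "(\<integral>\<^sup>+ x. ball_avg r (\<lambda>y. ennreal (h y)) x \<partial>m) \<le> ennreal D * mean_err r"
      unfolding mean_err_def using r nn_integral_ball_avg_le[of h r] by (simp add: h_def)
    show "(\<integral>\<^sup>+ x. ball_avg r (\<lambda>y. ennreal (d x y)) x \<partial>m) \<le> ennreal ((D + D * D) powr p) * mean_osc_int (2 * r)"
      unfolding d_def using r by (rule nn_integral_mean_shift_le)
  qed simp
  also have "\<dots> = ennreal (c * (1 + D)) * mean_err r + ennreal (c * (D + D * D) powr p) * mean_osc_int (2 * r)"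
    using D_ge_1 by (simp add: c_def ennreal_mult distrib_left distrib_right mult.assoc add_ac)
  finally show ?thesis by (simp add: c_def)
qed

lemma mean_err_le_add:
  "mean_err r \<le> ennreal (2 powr p) * mean_err \<rho> +
     ennreal (2 powr p) * (\<integral>\<^sup>+ x. ennreal (\<bar>ball_mean \<rho> f x - ball_mean r f x\<bar> powr p) \<partial>m)"
proof -
  have "ennreal (\<bar>f x - ball_mean r f x\<bar> powr p) \<le> ennreal (2 powr p) * ennreal (\<bar>f x - ball_mean \<rho> f x\<bar> powr p)
      + ennreal (2 powr p) * ennreal (\<bar>ball_mean \<rho> f x - ball_mean r f x\<bar> powr p)" for x
    using abs_powr_add_le[of p "f x - ball_mean \<rho> f x" "ball_mean \<rho> f x - ball_mean r f x"] p
    by (simp add: ennreal_leI distrib_left flip: ennreal_plus ennreal_mult)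
  then have "mean_err r \<le> (\<integral>\<^sup>+ x. ennreal (2 powr p) * ennreal (\<bar>f x - ball_mean \<rho> f x\<bar> powr p)
      + ennreal (2 powr p) * ennreal (\<bar>ball_mean \<rho> f x - ball_mean r f x\<bar> powr p) \<partial>m)"
    unfolding mean_err_def by (rule nn_integral_mono)
  also have "\<dots> = ennreal (2 powr p) * mean_err \<rho> +
     ennreal (2 powr p) * (\<integral>\<^sup>+ x. ennreal (\<bar>ball_mean \<rho> f x - ball_mean r f x\<bar> powr p) \<partial>m)"
    by (simp add: nn_integral_add nn_integral_cmult mean_err_def)
  finally show ?thesis .
qed

text \<open>The index starts at \<open>Suc n\<close> because the decay of the oscillation is
  formulated for radii at most 1/2.\<close>

lemma mean_err_dyadic_tendsto_0: "(\<lambda>n. mean_err (dyadic (Suc n))) \<longlonglongrightarrow> 0"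
proof -
  have "(\<lambda>n. lp_osc p (dyadic (Suc n)) f) \<longlonglongrightarrow> 0"
    using p fin dyadic_tendsto_0
    by (intro lp_osc_tendsto_0) (auto simp: dyadic_Suc_le_half[simplified] LIMSEQ_Suc)
  then have "(\<lambda>n. ennreal (2 powr p) * lp_osc p (dyadic (Suc n)) f) \<longlonglongrightarrow> ennreal (2 powr p) * 0"
    by (intro ennreal_tendsto_cmult) auto
  then have lim: "(\<lambda>n. ennreal (2 powr p) * lp_osc p (dyadic (Suc n)) f) \<longlonglongrightarrow> 0" by simp
  show ?thesis
    by (rule tendsto_sandwich[OF _ _ tendsto_const lim]) (auto intro!: always_eventually mean_err_le_lp_osc)
qed

text \<open>Any positive exponent e makes the increments summable; it remains free here and becomes
  s / 2 later.\<close>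

lemma nn_integral_mean_telescope_le:
  assumes "0 < e" "k \<le> N"
  shows "(\<integral>\<^sup>+ x. ennreal (\<bar>ball_mean (dyadic N) f x - ball_mean (dyadic k) f x\<bar> powr p) \<partial>m) \<le>
     ennreal ((1 / (1 - 2 powr (- e))) powr p * (D + 1) powr p * 2 powr (- (real k * e * p))) *
       (\<Sum>j=k..<N. ennreal (2 powr (real j * e * p)) * mean_osc_int (dyadic j))"
proof -
  define K where "K = (1 / (1 - 2 powr (- e))) powr p * 2 powr (- (real k * e * p))"
  define d where "d = (\<lambda>j x. \<bar>ball_mean (dyadic (Suc j)) f x - ball_mean (dyadic j) f x\<bar> powr p)"
  have [measurable]: "d j \<in> borel_measurable m" for j unfolding d_def by measurable
  have K: "0 \<le> K" by (simp add: K_def)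
  have step: "(\<integral>\<^sup>+ x. ennreal (d j x) \<partial>m) \<le> ennreal ((D + 1) powr p) * mean_osc_int (dyadic j)" for j
    using nn_integral_mean_step_le[of "dyadic (Suc j)"] dyadic_Suc_le_half[of j]
    by (simp add: dyadic_Suc d_def)
  have "\<bar>ball_mean (dyadic N) f x - ball_mean (dyadic k) f x\<bar> powr p \<le>
      K * (\<Sum>j=k..<N. 2 powr (real j * e * p) * d j x)" for x
    unfolding K_def d_def using assms p
    by (intro abs_diff_powr_le_weighted_sum[of e p k N "\<lambda>j. ball_mean (dyadic j) f x"]) auto
  then have "ennreal (\<bar>ball_mean (dyadic N) f x - ball_mean (dyadic k) f x\<bar> powr p) \<le>
      ennreal K * (\<Sum>j=k..<N. ennreal (2 powr (real j * e * p)) * ennreal (d j x))" for x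
    using K by (simp add: ennreal_leI d_def sum_nonneg flip: ennreal_mult)
  then have "(\<integral>\<^sup>+ x. ennreal (\<bar>ball_mean (dyadic N) f x - ball_mean (dyadic k) f x\<bar> powr p) \<partial>m) \<le>
      (\<integral>\<^sup>+ x. ennreal K * (\<Sum>j=k..<N. ennreal (2 powr (real j * e * p)) * ennreal (d j x)) \<partial>m)"
    by (rule nn_integral_mono)
  also have "\<dots> = ennreal K * (\<Sum>j=k..<N. ennreal (2 powr (real j * e * p)) * (\<integral>\<^sup>+ x. ennreal (d j x) \<partial>m))"
    by (simp add: nn_integral_cmult nn_integral_sum)
  also have "\<dots> \<le> ennreal K * (\<Sum>j=k..<N. ennreal (2 powr (real j * e * p)) *
      (ennreal ((D + 1) powr p) * mean_osc_int (dyadic j)))"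
    by (intro mult_left_mono sum_mono step) auto
  also have "\<dots> = ennreal K * (ennreal ((D + 1) powr p) *
      (\<Sum>j=k..<N. ennreal (2 powr (real j * e * p)) * mean_osc_int (dyadic j)))"
    by (simp add: sum_distrib_left mult_ac)
  also have "\<dots> = ennreal ((1 / (1 - 2 powr (- e))) powr p * (D + 1) powr p * 2 powr (- (real k * e * p))) *
       (\<Sum>j=k..<N. ennreal (2 powr (real j * e * p)) * mean_osc_int (dyadic j))"
    unfolding mult.assoc[symmetric] using K by (subst ennreal_mult[symmetric]) (auto simp: K_def mult_ac)
  finally show ?thesis .
qed

text \<open>The limit of the telescoping estimate as the finer scale tends to 0: its bound is a
  partial sum of the tail, and the error left at the finer scale vanishes.\<close>

lemma mean_err_dyadic_le:
  assumes "0 < e"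
  shows "mean_err (dyadic k) \<le>
     ennreal (2 powr p * (1 / (1 - 2 powr (- e))) powr p * (D + 1) powr p * 2 powr (- (real k * e * p))) *
       (\<Sum>j. if k \<le> j then ennreal (2 powr (real j * e * p)) * mean_osc_int (dyadic j) else 0)"
    (is "_ \<le> ?B")
proof -
  let ?K = "(1 / (1 - 2 powr (- e))) powr p * (D + 1) powr p * 2 powr (- (real k * e * p))"
  let ?w = "\<lambda>j. ennreal (2 powr (real j * e * p)) * mean_osc_int (dyadic j)"
  have le: "mean_err (dyadic k) \<le> ennreal (2 powr p) * mean_err (dyadic (Suc n)) + ?B" if "k \<le> n" for n
  proof -
    have "(\<Sum>j=k..<Suc n. ?w j) = (\<Sum>j=k..<Suc n. if k \<le> j then ?w j else 0)"
      by (intro sum.cong) auto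
    also have "\<dots> \<le> (\<Sum>j. if k \<le> j then ?w j else 0)"
      by (intro sum_le_suminf) auto
    finally have "(\<integral>\<^sup>+ x. ennreal (\<bar>ball_mean (dyadic (Suc n)) f x - ball_mean (dyadic k) f x\<bar> powr p) \<partial>m) \<le>
        ennreal ?K * (\<Sum>j. if k \<le> j then ?w j else 0)"
      using nn_integral_mean_telescope_le[OF assms, of k "Suc n"] that
      by (meson le_SucI mult_left_mono order_trans zero_le)
    then have "ennreal (2 powr p) * (\<integral>\<^sup>+ x. ennreal (\<bar>ball_mean (dyadic (Suc n)) f x - ball_mean (dyadic k) f x\<bar> powr p) \<partial>m)
        \<le> ennreal (2 powr p) * (ennreal ?K * (\<Sum>j. if k \<le> j then ?w j else 0))"
      by (rule mult_left_mono) simp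
    also have "\<dots> = ?B"
      unfolding mult.assoc[symmetric] by (subst ennreal_mult[symmetric]) (auto simp: mult_ac)
    finally show ?thesis
      using mean_err_le_add[of "dyadic k" "dyadic (Suc n)"] by (meson add_left_mono order_trans)
  qed
  have "(\<lambda>n. ennreal (2 powr p) * mean_err (dyadic (Suc n)) + ?B) \<longlonglongrightarrow> ennreal (2 powr p) * 0 + ?B"
    by (intro tendsto_add ennreal_tendsto_cmult mean_err_dyadic_tendsto_0 tendsto_const) auto
  then have "mean_err (dyadic k) \<le> ennreal (2 powr p) * 0 + ?B"
    by (rule Lim_bounded2[where N = k]) (use le in auto)
  then show ?thesis by simp
qed

section \<open>Summation over all scales\<close>

lemma mean_osc_sum_le_lp_osc_sum:
  "(\<Sum>k. if 1 \<le> k then ennreal (2 powr (real k * s * p)) * mean_osc_int (dyadic k) else 0) \<le>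
     ennreal (2 powr p) * (\<Sum>k. if 1 \<le> k then ennreal (2 powr (real k * s * p)) * lp_osc p (dyadic k) f else 0)"
proof -
  have "(\<Sum>k. if 1 \<le> k then ennreal (2 powr (real k * s * p)) * mean_osc_int (dyadic k) else 0) \<le>
     (\<Sum>k. ennreal (2 powr p) * (if 1 \<le> k then ennreal (2 powr (real k * s * p)) * lp_osc p (dyadic k) f else 0))"
  proof (intro suminf_le summableI)
    fix k
    have "ennreal (2 powr (real k * s * p)) * mean_osc_int (dyadic k) \<le>
        ennreal (2 powr (real k * s * p)) * (ennreal (2 powr p) * lp_osc p (dyadic k) f)"
      by (intro mult_left_mono mean_osc_int_le_lp_osc) auto
    then show "(if 1 \<le> k then ennreal (2 powr (real k * s * p)) * mean_osc_int (dyadic k) else 0) \<le>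
       ennreal (2 powr p) * (if 1 \<le> k then ennreal (2 powr (real k * s * p)) * lp_osc p (dyadic k) f else 0)"
      by (simp add: mult_ac)
  qed
  then show ?thesis by simp
qed

text \<open>\<open>C1\<close> and \<open>C2\<close> come from splitting f(x) - f(y),
  \<open>C3\<close> from telescoping with e = s / 2, and \<open>Q / (Q - 1)\<close> from the Hardy
  inequality. The factor Q^2 next to \<open>C2\<close> pays for moving the weight by one scale; the
  remaining summand bounds the term k = 1.\<close>

lemma lp_osc_sum_le:
  fixes s :: real
  assumes s: "0 < s"
  defines "Q \<equiv> 2 powr (s * p / 2)"
    and "C1 \<equiv> 4 powr p * (1 + D)" and "C2 \<equiv> 4 powr p * (D + D * D) powr p"
    and "C3 \<equiv> 2 powr p * (1 / (1 - 2 powr (- (s / 2)))) powr p * (D + 1) powr p"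
  shows "(\<Sum>k. if 1 \<le> k then ennreal (2 powr (real k * s * p)) * lp_osc p (dyadic k) f else 0) \<le>
     ennreal (Q\<^sup>2 * (2 powr p * (1 + D)) + (C1 * C3 * (Q / (Q - 1)) + C2 * Q\<^sup>2)) *
       ((\<integral>\<^sup>+ x. ennreal (\<bar>f x\<bar> powr p) \<partial>m) +
        (\<Sum>k. if 1 \<le> k then ennreal (2 powr (real k * s * p)) * mean_osc_int (dyadic k) else 0))"
proof -
  \<comment> \<open>The Besov norm has no term k = 0; giving it the value 0 lets the sums below
    start at 0.\<close>
  define e where "e = (\<lambda>k. if 1 \<le> k then mean_osc_int (dyadic k) else 0)"
  define T where "T = (\<lambda>k. lp_osc p (dyadic k) f)"
  define N where "N = (\<integral>\<^sup>+ x. ennreal (\<bar>f x\<bar> powr p) \<partial>m)"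
  define H where "H = (\<lambda>k. ennreal (Q ^ k) * (\<Sum>j. if k \<le> j then ennreal (Q ^ j) * e j else 0))"
  define E where "E = (\<Sum>k. ennreal (Q ^ (2 * k)) * e k)"
  have Q: "1 < Q" using s p by (simp add: Q_def)
  have C: "0 \<le> C1" "0 \<le> C2" "0 \<le> C3" using D_ge_1 by (auto simp: C1_def C2_def C3_def)
  have Qk: "Q ^ k = 2 powr (real k * (s / 2) * p)" for k
    using Q by (simp add: Q_def powr_powr flip: powr_realpow) (simp add: mult_ac)
  have Q2: "2 powr (real k * s * p) = Q ^ (2 * k)" for k
    by (simp add: Qk)
  have QQ: "Q ^ k * 2 powr (- (real k * (s / 2) * p)) = 1" for k
    unfolding Qk by (simp flip: powr_add)
  have E_eq: "(\<Sum>k. if 1 \<le> k then ennreal (2 powr (real k * s * p)) * mean_osc_int (dyadic k) else 0) = E"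
    unfolding E_def Q2 e_def by (intro suminf_cong) auto
  \<comment> \<open>One of the two factors Q^k in the weight cancels the decay 2^(-k s p / 2) of the
    mean error; the other remains as the outer weight in \<open>H\<close>.\<close>
  have err: "ennreal (Q ^ (2 * k)) * mean_err (dyadic k) \<le> ennreal C3 * H k" if "1 \<le> k" for k
  proof -
    let ?tail = "\<Sum>j. if k \<le> j then ennreal (Q ^ j) * e j else 0"
    have "mean_err (dyadic k) \<le> ennreal (C3 * 2 powr (- (real k * (s / 2) * p))) *
        (\<Sum>j. if k \<le> j then ennreal (Q ^ j) * mean_osc_int (dyadic j) else 0)"
      using mean_err_dyadic_le[of "s / 2" k] s unfolding Qk C3_def by simp
    also have "(\<Sum>j. if k \<le> j then ennreal (Q ^ j) * mean_osc_int (dyadic j) else 0) = ?tail"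
      using that by (intro suminf_cong) (auto simp: e_def)
    finally have "ennreal (Q ^ (2 * k)) * mean_err (dyadic k) \<le>
        ennreal (Q ^ (2 * k)) * (ennreal (C3 * 2 powr (- (real k * (s / 2) * p))) * ?tail)"
      by (intro mult_left_mono) auto
    also have "\<dots> = ennreal (Q ^ (2 * k) * (C3 * 2 powr (- (real k * (s / 2) * p)))) * ?tail"
      using Q C by (simp add: ennreal_mult mult.assoc)
    also have "Q ^ (2 * k) * (C3 * 2 powr (- (real k * (s / 2) * p))) = C3 * Q ^ k"
    proof -
      have "Q ^ (2 * k) * (C3 * 2 powr (- (real k * (s / 2) * p))) =
          C3 * Q ^ k * (Q ^ k * 2 powr (- (real k * (s / 2) * p)))"
        unfolding mult_2 power_add by (simp only: mult_ac)
      then show ?thesis by (simp only: QQ mult_1_right)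
    qed
    finally show ?thesis
      using C Q by (simp add: H_def ennreal_mult mult.assoc)
  qed
  \<comment> \<open>The oscillation at scale k involves the mean oscillation at scale k - 1, so this
    bound starts at k = 2.\<close>
  have step: "ennreal (Q ^ (2 * (i + 2))) * T (i + 2) \<le>
      ennreal (C1 * C3) * H (i + 2) + ennreal (C2 * Q\<^sup>2) * (ennreal (Q ^ (2 * (i + 1))) * e (i + 1))" for i
  proof -
    have "T (i + 2) \<le> ennreal C1 * mean_err (dyadic (i + 2)) + ennreal C2 * mean_osc_int (dyadic (i + 1))"
      unfolding T_def C1_def C2_def
      using lp_osc_le_mean_err[of "dyadic (i + 2)"] dyadic_Suc_le_half[of "i + 1"] dyadic_Suc[of "i + 1"] by simp
    then have "ennreal (Q ^ (2 * (i + 2))) * T (i + 2) \<le> ennreal (Q ^ (2 * (i + 2))) *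
        (ennreal C1 * mean_err (dyadic (i + 2)) + ennreal C2 * mean_osc_int (dyadic (i + 1)))"
      by (rule mult_left_mono) simp
    also have "\<dots> = ennreal C1 * (ennreal (Q ^ (2 * (i + 2))) * mean_err (dyadic (i + 2))) +
        ennreal C2 * (ennreal (Q ^ (2 * (i + 2))) * e (i + 1))"
      by (simp add: distrib_left mult_ac e_def)
    also have "\<dots> \<le> ennreal C1 * (ennreal C3 * H (i + 2)) + ennreal C2 * (ennreal (Q ^ (2 * (i + 2))) * e (i + 1))"
      by (intro add_right_mono mult_left_mono err) auto
    also have "ennreal (Q ^ (2 * (i + 2))) * e (i + 1) = ennreal (Q\<^sup>2) * (ennreal (Q ^ (2 * (i + 1))) * e (i + 1))"
    proof -
      have "Q ^ (2 * (i + 2)) = Q\<^sup>2 * Q ^ (2 * (i + 1))"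
        by (simp flip: power_add)
      then show ?thesis
        using Q by (simp only: mult.assoc ennreal_mult zero_le_power2 zero_le_power less_imp_le[OF less_trans[OF zero_less_one Q]])
    qed
    finally show ?thesis
      by (simp only: ennreal_mult C zero_le_power2 mult.assoc)
  qed
  \<comment> \<open>The bound in \<open>step\<close> would bring in the ball of radius 1, which does
    not occur in the norm.\<close>
  have T1: "T 1 \<le> ennreal (2 powr p * (1 + D)) * N"
    unfolding T_def N_def using p dyadic_Suc_le_half[of 0] by (intro lp_osc_le_Lp) auto
  have "(\<Sum>k. if 1 \<le> k then ennreal (2 powr (real k * s * p)) * lp_osc p (dyadic k) f else 0) =
      (\<Sum>k. if 1 \<le> k then ennreal (Q ^ (2 * k)) * T k else 0)"
    unfolding Q2 T_def ..
  \<comment> \<open>Of the two separated initial terms, the one with k = 0 is zero.\<close>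
  also have "\<dots> = (\<Sum>i. ennreal (Q ^ (2 * (i + 2))) * T (i + 2)) + ennreal (Q\<^sup>2) * T 1"
    by (subst suminf_offset[where i = 2]) (auto simp: numeral_2_eq_2)
  also have "\<dots> \<le> (\<Sum>i. ennreal (C1 * C3) * H (i + 2) + ennreal (C2 * Q\<^sup>2) * (ennreal (Q ^ (2 * (i + 1))) * e (i + 1)))
      + ennreal (Q\<^sup>2) * (ennreal (2 powr p * (1 + D)) * N)"
    by (intro add_mono suminf_le mult_left_mono step T1) auto
  also have "(\<Sum>i. ennreal (C1 * C3) * H (i + 2) + ennreal (C2 * Q\<^sup>2) * (ennreal (Q ^ (2 * (i + 1))) * e (i + 1))) =
      ennreal (C1 * C3) * (\<Sum>i. H (i + 2)) + ennreal (C2 * Q\<^sup>2) * (\<Sum>i. ennreal (Q ^ (2 * (i + 1))) * e (i + 1))"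
    by (subst suminf_add[symmetric]) (simp_all only: summableI ennreal_suminf_cmult)
  also have "\<dots> \<le> ennreal (C1 * C3) * (ennreal (Q / (Q - 1)) * E) + ennreal (C2 * Q\<^sup>2) * E"
  proof (intro add_mono mult_left_mono)
    have "(\<Sum>i. H (i + 2)) \<le> (\<Sum>i. H i)"
      by (subst (2) suminf_offset[where i = 2]) auto
    also have "\<dots> \<le> ennreal (Q / (Q - 1)) * E"
      unfolding H_def E_def by (rule geometric_tail_sum_le[OF Q])
    finally show "(\<Sum>i. H (i + 2)) \<le> ennreal (Q / (Q - 1)) * E" .
    show "(\<Sum>i. ennreal (Q ^ (2 * (i + 1))) * e (i + 1)) \<le> E"
      unfolding E_def by (subst (2) suminf_offset[where i = 1]) auto
  qed auto
  also have "ennreal (C1 * C3) * (ennreal (Q / (Q - 1)) * E) + ennreal (C2 * Q\<^sup>2) * E =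
      ennreal (C1 * C3 * (Q / (Q - 1)) + C2 * Q\<^sup>2) * E"
  proof -
    have "0 \<le> Q / (Q - 1)" using Q by simp
    with C show ?thesis
      by (simp only: ennreal_plus ennreal_mult mult_nonneg_nonneg zero_le_power2 distrib_right mult.assoc)
  qed
  also have "ennreal (Q\<^sup>2) * (ennreal (2 powr p * (1 + D)) * N) = ennreal (Q\<^sup>2 * (2 powr p * (1 + D))) * N"
    using D_ge_1 by (simp add: ennreal_mult mult.assoc)
  \<comment> \<open>Both coefficients are enlarged to their sum, so that N + E can be factored
    out.\<close>
  also have "ennreal (C1 * C3 * (Q / (Q - 1)) + C2 * Q\<^sup>2) * E + ennreal (Q\<^sup>2 * (2 powr p * (1 + D))) * N \<le>
      ennreal (Q\<^sup>2 * (2 powr p * (1 + D)) + (C1 * C3 * (Q / (Q - 1)) + C2 * Q\<^sup>2)) * E +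
      ennreal (Q\<^sup>2 * (2 powr p * (1 + D)) + (C1 * C3 * (Q / (Q - 1)) + C2 * Q\<^sup>2)) * N"
  proof -
    have "ennreal b * E + ennreal a * N \<le> ennreal (a + b) * E + ennreal (a + b) * N"
      if "0 \<le> a" "0 \<le> b" for a b :: real
      using that by (intro add_mono mult_right_mono ennreal_leI) auto
    from this[of "Q\<^sup>2 * (2 powr p * (1 + D))" "C1 * C3 * (Q / (Q - 1)) + C2 * Q\<^sup>2"] show ?thesis
      using C Q D_ge_1 by auto
  qed
  finally show ?thesis
    unfolding E_eq N_def[symmetric] by (simp add: distrib_left add.commute add_right_mono)
qed

end

end

section \<open>The Hausdorff-type measure\<close>

lemma suminf_tail_tendsto_0_ennreal:
  fixes g :: "nat \<Rightarrow> ennreal"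
  assumes fin: "(\<Sum>i. g i) < top"
  shows "(\<lambda>n. \<Sum>i. g (i + n)) \<longlonglongrightarrow> 0"
proof (rule tendsto_0_ennrealI)
  fix e :: real assume "0 < e"
  have "(\<lambda>n. (\<Sum>i<n. g i) + ennreal e) \<longlonglongrightarrow> (\<Sum>i. g i) + ennreal e"
    by (intro tendsto_intros summable_LIMSEQ summableI)
  moreover have "(\<Sum>i. g i) < (\<Sum>i. g i) + ennreal e"
    using fin \<open>0 < e\<close> by simp
  ultimately have "eventually (\<lambda>n. (\<Sum>i. g i) < (\<Sum>i<n. g i) + ennreal e) sequentially"
    by (rule order_tendstoD(1))
  then show "eventually (\<lambda>n. (\<Sum>i. g (i + n)) \<le> ennreal e) sequentially"
  proof eventually_elim
    case (elim n)
    have "(\<Sum>i<n. g i) \<le> (\<Sum>i. g i)"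
      by (rule sum_le_suminf) auto
    then have part: "(\<Sum>i<n. g i) < top"
      using fin by (rule le_less_trans)
    have "(\<Sum>i<n. g i) + (\<Sum>i. g (i + n)) \<le> (\<Sum>i<n. g i) + ennreal e"
      using elim by (subst (asm) suminf_offset[where i = n]) (auto simp: add.commute)
    then show ?case
      using part by (metis ennreal_add_left_cancel_le infinity_ennreal_def less_irrefl)
  qed
qed

text \<open>Caratheodory's criterion. For closed \<open>C\<close>, the layers of \<open>X - C\<close> at distance about \<open>1 / j\<close> from
  \<open>C\<close> have finite total mass, since layers with indices of the same parity are separated; so the
  part of \<open>X - C\<close> at positive distance from \<open>C\<close> exhausts \<open>X - C\<close> in measure.\<close>

lemma measure_space_borel_of_metric_outer_measure:
  fixes f :: "'a::metric_space set \<Rightarrow> ennreal"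
  assumes empty: "f {} = 0"
    and mono: "\<And>A B. A \<subseteq> B \<Longrightarrow> f A \<le> f B"
    and subadd: "\<And>A :: nat \<Rightarrow> 'a set. f (\<Union>i. A i) \<le> (\<Sum>i. f (A i))"
    and sep: "\<And>A B d. 0 < d \<Longrightarrow> (\<And>x y. x \<in> A \<Longrightarrow> y \<in> B \<Longrightarrow> d \<le> dist x y) \<Longrightarrow> f A + f B \<le> f (A \<union> B)"
  shows "measure_space UNIV (sets borel) f"
proof -
  have subadd2: "f (A \<union> B) \<le> f A + f B" for A B
  proof -
    have "f (A \<union> B) = f (\<Union>i::nat. if i = 0 then A else if i = 1 then B else {})"
      by (intro arg_cong[where f = f]) (auto split: if_splits)
    also have "\<dots> \<le> (\<Sum>i::nat. f (if i = 0 then A else if i = 1 then B else {}))"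
      by (rule subadd)
    also have "\<dots> = f A + f B"
      by (subst suminf_finite[of "{0, 1}"]) (auto simp: empty)
    finally show ?thesis .
  qed
  \<comment> \<open>Closed sets suffice because they generate the Borel sets and the
    Caratheodory-measurable sets form a sigma-algebra. The empty set is excluded: the distance to it
    is 0 by convention.\<close>
  have closed_split: "f (X \<inter> C) + f (X - C) \<le> f X" if C: "closed C" "C \<noteq> {}" and X: "f X < top" for X C
  proof -
    define R where "R = (\<lambda>j::nat. {y \<in> X. 1 / (real j + 2) \<le> infdist y C \<and> infdist y C < 1 / (real j + 1)})"
    define A where "A = (\<lambda>n::nat. {y \<in> X. 1 / (real n + 1) \<le> infdist y C})"
    have layers: "(\<Sum>i. f (R (2 * i + c))) < top" for c :: nat
    proof -
      have "(\<Sum>i<n. f (R (2 * i + c))) \<le> f (\<Union>i<n. R (2 * i + c))" for n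
      proof (induction n)
        case (Suc n)
        have "(\<Sum>i<Suc n. f (R (2 * i + c))) \<le> f (\<Union>i<n. R (2 * i + c)) + f (R (2 * n + c))"
          using Suc by (simp add: add_right_mono)
        also have "\<dots> \<le> f ((\<Union>i<n. R (2 * i + c)) \<union> R (2 * n + c))"
        proof (cases "n = 0")
          case False
          \<comment> \<open>For i < n the earlier layers stay at distance at least 1/k from C, and
            layer k stays below 1/(k+1); the skipped layer leaves the gap. For n = 0 the number k
            might be 0.\<close>
          define k where "k = real (2 * n + c)"
          have k: "1 \<le> k" using False by (simp add: k_def)
          show ?thesis
          proof (rule sep)
            have "1 / (k + 1) < 1 / k" using k by (intro divide_strict_left_mono) auto
            then show "0 < 1 / k - 1 / (k + 1)" by simp
            fix x y assume "x \<in> (\<Union>i<n. R (2 * i + c))" and y: "y \<in> R (2 * n + c)"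
            then obtain i where i: "i < n" "x \<in> R (2 * i + c)" by auto
            have "1 / k \<le> 1 / (real (2 * i + c) + 2)"
              using i(1) by (intro divide_left_mono) (auto simp: k_def)
            then have "1 / k \<le> infdist x C" using i(2) by (auto simp: R_def)
            moreover have "infdist y C < 1 / (k + 1)" using y by (auto simp: R_def k_def)
            ultimately show "1 / k - 1 / (k + 1) \<le> dist x y"
              using infdist_triangle[of x C y] by linarith
          qed
        qed (simp add: empty)
        also have "(\<Union>i<n. R (2 * i + c)) \<union> R (2 * n + c) = (\<Union>i<Suc n. R (2 * i + c))"
          by (auto simp: lessThan_Suc)
        finally show ?case .
      qed (simp add: empty)
      also have "f (\<Union>i<n. R (2 * i + c)) \<le> f X" for n
        by (intro mono) (auto simp: R_def)
      finally have "(\<Sum>i. f (R (2 * i + c))) \<le> f X"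
        by (intro suminf_le_const summableI)
      then show ?thesis using X by (rule le_less_trans)
    qed
    \<comment> \<open>Points closer to C than 1/(2n+1) lie in a layer of index at least 2n; these
      indices are listed by parity to match tails of the two convergent series.\<close>
    have cover: "X - C \<subseteq> A (2 * n) \<union> ((\<Union>i. R (2 * (i + n) + 0)) \<union> (\<Union>i. R (2 * (i + n) + 1)))" for n
    proof
      fix y assume y: "y \<in> X - C"
      then have pos: "0 < infdist y C" using C by (intro infdist_pos_not_in_closed) auto
      show "y \<in> A (2 * n) \<union> ((\<Union>i. R (2 * (i + n) + 0)) \<union> (\<Union>i. R (2 * (i + n) + 1)))"
      proof (cases "1 / (real (2 * n) + 1) \<le> infdist y C")
        case False
        define P where "P = (\<lambda>j::nat. 1 / (real j + 1) \<le> infdist y C)"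
        obtain N where "inverse (real (Suc N)) < infdist y C"
          using reals_Archimedean[OF pos] by blast
        then have "P N"
          by (simp add: P_def inverse_eq_divide add.commute)
        define k where "k = (LEAST j. P j)"
        have k: "P k" unfolding k_def by (rule LeastI[of P, OF \<open>P N\<close>])
        have kn: "2 * n < k"
        proof (rule ccontr)
          assume "\<not> 2 * n < k"
          then have "1 / (real (2 * n) + 1) \<le> 1 / (real k + 1)" by (intro divide_left_mono) auto
          with k False show False by (simp add: P_def)
        qed
        then obtain j where j: "k = Suc j" by (cases k) auto
        have "\<not> P j" using j not_less_Least[of j P] by (simp add: k_def)
        then have "y \<in> R j" using k y by (auto simp: R_def P_def j add.commute)
        moreover have "\<exists>i. j = 2 * (i + n) + 0 \<or> j = 2 * (i + n) + 1"
          using kn j by presburger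
        ultimately show ?thesis by blast
      qed (use y in \<open>auto simp: A_def\<close>)
    qed
    define t where "t = (\<lambda>n. (\<Sum>i. f (R (2 * (i + n) + 0))) + (\<Sum>i. f (R (2 * (i + n) + 1))))"
    have "t \<longlonglongrightarrow> 0 + 0"
      unfolding t_def by (intro tendsto_add suminf_tail_tendsto_0_ennreal layers)
    have le: "f (X \<inter> C) + f (X - C) \<le> f X + t n" for n
    proof -
      have "f (X - C) \<le> f (A (2 * n)) + t n"
        unfolding t_def
        by (rule order_trans[OF mono[OF cover] order_trans[OF subadd2 add_left_mono[OF order_trans[OF subadd2 add_mono[OF subadd subadd]]]]])
      then have "f (X \<inter> C) + f (X - C) \<le> (f (X \<inter> C) + f (A (2 * n))) + t n"
        unfolding add.assoc by (rule add_left_mono)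
      also have "f (X \<inter> C) + f (A (2 * n)) \<le> f ((X \<inter> C) \<union> A (2 * n))"
      proof (rule sep)
        show "0 < 1 / (real (2 * n) + 1)" by (simp add: add_nonneg_pos)
        fix x y assume "x \<in> X \<inter> C" "y \<in> A (2 * n)"
        then show "1 / (real (2 * n) + 1) \<le> dist x y"
          using infdist_le[of x C y] by (auto simp: A_def dist_commute)
      qed
      also have "\<dots> \<le> f X" by (intro mono) (auto simp: A_def)
      finally show ?thesis by (simp add: add_right_mono)
    qed
    have "(\<lambda>n. f X + t n) \<longlonglongrightarrow> f X + 0"
      using \<open>t \<longlonglongrightarrow> 0 + 0\<close> by (intro tendsto_intros) simp
    then have "f (X \<inter> C) + f (X - C) \<le> f X + 0"
      by (rule Lim_bounded2[where N = 0]) (use le in auto)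
    then show ?thesis by simp
  qed
  interpret P: sigma_algebra UNIV "Pow UNIV :: 'a set set" by (rule sigma_algebra_Pow)
  define L where "L = lambda_system UNIV (Pow UNIV) f"
  have "outer_measure_space (Pow UNIV) f"
    unfolding outer_measure_space_def positive_def increasing_def countably_subadditive_def
    using empty mono subadd by auto
  from P.caratheodory_lemma[OF this] have L: "measure_space UNIV L f"
    by (simp add: L_def)
  have "Collect closed \<subseteq> L"
  proof
    fix C :: "'a set" assume "C \<in> Collect closed"
    then have C: "closed C" by simp
    have "f (X \<inter> C) + f (X - C) = f X" for X
    proof (rule antisym)
      show "f (X \<inter> C) + f (X - C) \<le> f X"
        using closed_split[OF C, of X] by (cases "C = {}"; cases "f X < top") (auto simp: empty less_top[symmetric])
      show "f X \<le> f (X \<inter> C) + f (X - C)"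
        using subadd2[of "X \<inter> C" "X - C"] by (simp add: Int_Diff_Un)
    qed
    then show "C \<in> L" unfolding L_def P.lambda_system_eq by simp
  qed
  then have "sets borel \<subseteq> L"
    using L unfolding borel_eq_closed
    by (simp add: measure_space_def sigma_algebra.sigma_sets_subset)
  then show ?thesis
    using L sets.sigma_algebra_axioms[of "borel :: 'a measure"]
    by (auto simp: measure_space_def positive_def countably_additive_def)
qed

section \<open>The Hausdorff-type contents and their limit\<close>

lemma H_delta_le:
  assumes "E \<subseteq> (\<Union>i\<in>I. cball (c i) (r i))" "\<And>i. i \<in> I \<Longrightarrow> 0 < r i \<and> r i < \<delta>"
  shows "H_delta \<mu> \<theta> \<delta> E \<le>
    (\<Sum>i. if i \<in> I then emeasure \<mu> (cball (c i) (r i)) * ennreal (r i powr (- \<theta>)) else 0)"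
proof -
  have "(I, c, r) \<in> {(I, c, r) | (I::nat set) c r. E \<subseteq> (\<Union>i\<in>I. cball (c i) (r i)) \<and> (\<forall>i\<in>I. 0 < r i \<and> r i < \<delta>)}"
    using assms by auto
  then show ?thesis
    unfolding H_delta_def by (rule INF_lower2) simp
qed

lemma H_delta_greatest:
  assumes "\<And>I c r. E \<subseteq> (\<Union>i\<in>I. cball (c i) (r i)) \<Longrightarrow> (\<And>i. i \<in> I \<Longrightarrow> 0 < r i \<and> r i < \<delta>) \<Longrightarrow>
    x \<le> (\<Sum>i. if i \<in> I then emeasure \<mu> (cball (c i) (r i)) * ennreal (r i powr (- \<theta>)) else 0)"
  shows "x \<le> H_delta \<mu> \<theta> \<delta> E"
  unfolding H_delta_def by (rule INF_greatest) (use assms in auto)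

lemma H_delta_approx:
  assumes "H_delta \<mu> \<theta> \<delta> E < y"
  obtains I c r where "E \<subseteq> (\<Union>i\<in>I. cball (c i) (r i))" "\<And>i. i \<in> I \<Longrightarrow> 0 < r i \<and> r i < \<delta>"
    "(\<Sum>i. if i \<in> I then emeasure \<mu> (cball (c i) (r i)) * ennreal (r i powr (- \<theta>)) else 0) < y"
  using assms H_delta_greatest[of E \<delta> y \<mu> \<theta>] by (meson leD not_le_imp_less)

lemma H_delta_empty: "H_delta \<mu> \<theta> \<delta> {} = 0"
  using H_delta_le[where E = "{}" and I = "{}" and \<delta> = \<delta> and \<mu> = \<mu> and \<theta> = \<theta>] by simp

lemma H_delta_mono: "A \<subseteq> B \<Longrightarrow> H_delta \<mu> \<theta> \<delta> A \<le> H_delta \<mu> \<theta> \<delta> B"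
  by (rule H_delta_greatest, rule H_delta_le) auto

lemma H_delta_antimono: "\<delta> \<le> \<delta>' \<Longrightarrow> H_delta \<mu> \<theta> \<delta>' A \<le> H_delta \<mu> \<theta> \<delta> A"
  by (rule H_delta_greatest, rule H_delta_le) force+

text \<open>Covers of \<open>A n\<close> that are optimal up to e / 2^(n+1) are merged into one
  sequence by the pairing of natural numbers.\<close>

lemma H_delta_subadditive:
  fixes A :: "nat \<Rightarrow> 'a::metric_space set"
  shows "H_delta \<mu> \<theta> \<delta> (\<Union>n. A n) \<le> (\<Sum>n. H_delta \<mu> \<theta> \<delta> (A n))"
proof (cases "(\<Sum>n. H_delta \<mu> \<theta> \<delta> (A n)) < top")
  case True
  define w where "w = (\<lambda>x r. emeasure \<mu> (cball x r) * ennreal (r powr (- \<theta>)))"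
  show ?thesis
  proof (rule ennreal_le_epsilon)
    fix e :: real assume e: "0 < e"
    define good where "good = (\<lambda>n I c r. A n \<subseteq> (\<Union>i\<in>I. cball (c i) (r i)) \<and> (\<forall>i\<in>I. 0 < r i \<and> r i < \<delta>) \<and>
        (\<Sum>i. if i \<in> I then w (c i) (r i) else 0) \<le> H_delta \<mu> \<theta> \<delta> (A n) + ennreal (e * (1/2) ^ Suc n))"
    have "\<exists>I c r. good n I c r" for n
    proof -
      have "H_delta \<mu> \<theta> \<delta> (A n) \<noteq> top"
        using True ennreal_suminf_lessD[of "\<lambda>n. H_delta \<mu> \<theta> \<delta> (A n)"] by (auto simp: less_top)
      then have "H_delta \<mu> \<theta> \<delta> (A n) < H_delta \<mu> \<theta> \<delta> (A n) + ennreal (e * (1/2) ^ Suc n)"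
        using e by (simp add: less_top)
      then obtain I c r where "A n \<subseteq> (\<Union>i\<in>I. cball (c i) (r i))" "\<forall>i\<in>I. 0 < r i \<and> r i < \<delta>"
        and "(\<Sum>i. if i \<in> I then w (c i) (r i) else 0) < H_delta \<mu> \<theta> \<delta> (A n) + ennreal (e * (1/2) ^ Suc n)"
        unfolding w_def by (rule H_delta_approx) blast
      then show ?thesis
        unfolding good_def by (intro exI[of _ I] exI[of _ c] exI[of _ r] conjI) (assumption | erule less_imp_le)+
    qed
    then obtain I c r where "\<And>n. good n (I n) (c n) (r n)" by metis
    then have cov: "\<And>n. A n \<subseteq> (\<Union>i\<in>I n. cball (c n i) (r n i))"
      and rad: "\<And>n i. i \<in> I n \<Longrightarrow> 0 < r n i \<and> r n i < \<delta>"
      and sum: "\<And>n. (\<Sum>i. if i \<in> I n then w (c n i) (r n i) else 0) \<le> H_delta \<mu> \<theta> \<delta> (A n) + ennreal (e * (1/2) ^ Suc n)"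
      unfolding good_def by blast+
    define J where "J = {k. case prod_decode k of (n, i) \<Rightarrow> i \<in> I n}"
    define c' where "c' = (\<lambda>k. case prod_decode k of (n, i) \<Rightarrow> c n i)"
    define r' where "r' = (\<lambda>k. case prod_decode k of (n, i) \<Rightarrow> r n i)"
    have "H_delta \<mu> \<theta> \<delta> (\<Union>n. A n) \<le> (\<Sum>k. if k \<in> J then w (c' k) (r' k) else 0)"
      unfolding w_def
    proof (rule H_delta_le)
      show "(\<Union>n. A n) \<subseteq> (\<Union>k\<in>J. cball (c' k) (r' k))"
      proof
        fix x assume "x \<in> (\<Union>n. A n)"
        then obtain n where "x \<in> A n" by auto
        then obtain i where "i \<in> I n" "x \<in> cball (c n i) (r n i)" using cov[of n] by auto
        then show "x \<in> (\<Union>k\<in>J. cball (c' k) (r' k))"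
          by (intro UN_I[of "prod_encode (n, i)"]) (auto simp: J_def c'_def r'_def)
      qed
    qed (use rad in \<open>auto simp: J_def r'_def split: prod.splits\<close>)
    also have "\<dots> = (\<Sum>k. (\<lambda>(n, i). if i \<in> I n then w (c n i) (r n i) else 0) (prod_decode k))"
      by (intro suminf_cong) (auto simp: J_def c'_def r'_def split: prod.splits)
    also have "\<dots> = (\<Sum>n. \<Sum>i. if i \<in> I n then w (c n i) (r n i) else 0)"
      by (rule suminf_ennreal_2dimen) simp
    also have "\<dots> \<le> (\<Sum>n. H_delta \<mu> \<theta> \<delta> (A n) + ennreal (e * (1/2) ^ Suc n))"
      by (intro suminf_le sum summableI)
    also have "\<dots> = (\<Sum>n. H_delta \<mu> \<theta> \<delta> (A n)) + (\<Sum>n. ennreal (e * (1/2) ^ Suc n))"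
      by (intro suminf_add[symmetric] summableI)
    also have "(\<Sum>n. ennreal (e * (1/2) ^ Suc n)) = ennreal (e * 1)"
      using e by (intro suminf_ennreal_eq sums_mult power_half_series) auto
    finally show "H_delta \<mu> \<theta> \<delta> (\<Union>n. A n) \<le> (\<Sum>n. H_delta \<mu> \<theta> \<delta> (A n)) + ennreal e" by simp
  qed
qed (simp add: less_top[symmetric])

text \<open>Two points of a ball of radius below \<delta> are less than 2 \<delta> apart, so no ball
  meets both sets and every cover splits into two disjoint subfamilies.\<close>

lemma H_delta_separated:
  assumes sep: "\<And>x y. x \<in> A \<Longrightarrow> y \<in> B \<Longrightarrow> 2 * \<delta> \<le> dist x y"
  shows "H_delta \<mu> \<theta> \<delta> A + H_delta \<mu> \<theta> \<delta> B \<le> H_delta \<mu> \<theta> \<delta> (A \<union> B)"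
proof (rule H_delta_greatest)
  fix I :: "nat set" and c r
  assume cov: "A \<union> B \<subseteq> (\<Union>i\<in>I. cball (c i) (r i))" and rad: "\<And>i. i \<in> I \<Longrightarrow> 0 < r i \<and> r i < \<delta>"
  define w where "w = (\<lambda>i::nat. emeasure \<mu> (cball (c i) (r i)) * ennreal (r i powr (- \<theta>)))"
  define IA where "IA = {i \<in> I. cball (c i) (r i) \<inter> A \<noteq> {}}"
  define IB where "IB = {i \<in> I. cball (c i) (r i) \<inter> B \<noteq> {}}"
  have disj: "i \<notin> IB" if "i \<in> IA" for i
  proof
    assume "i \<in> IB"
    with that obtain x y where "x \<in> A" "y \<in> B" "i \<in> I" "dist (c i) x \<le> r i" "dist (c i) y \<le> r i"
      by (auto simp: IA_def IB_def)
    then show False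
      using sep[of x y] rad[of i] dist_triangle3[of x y "c i"] by auto
  qed
  have "H_delta \<mu> \<theta> \<delta> A + H_delta \<mu> \<theta> \<delta> B \<le> (\<Sum>i. if i \<in> IA then w i else 0) + (\<Sum>i. if i \<in> IB then w i else 0)"
  proof -
    have "A \<subseteq> (\<Union>i\<in>IA. cball (c i) (r i))" "B \<subseteq> (\<Union>i\<in>IB. cball (c i) (r i))"
      using cov unfolding IA_def IB_def by blast+
    then show ?thesis
      unfolding w_def using rad by (intro add_mono H_delta_le) (auto simp: IA_def IB_def)
  qed
  also have "\<dots> = (\<Sum>i. (if i \<in> IA then w i else 0) + (if i \<in> IB then w i else 0))"
    by (intro suminf_add summableI)
  also have "\<dots> \<le> (\<Sum>i. if i \<in> I then w i else 0)"
    using disj by (intro suminf_le summableI) (auto simp: IA_def IB_def)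
  finally show "H_delta \<mu> \<theta> \<delta> A + H_delta \<mu> \<theta> \<delta> B \<le>
      (\<Sum>i. if i \<in> I then emeasure \<mu> (cball (c i) (r i)) * ennreal (r i powr (- \<theta>)) else 0)"
    unfolding w_def .
qed

lemma H_delta_le_H_theta: "0 < \<delta> \<Longrightarrow> H_delta \<mu> \<theta> \<delta> A \<le> H_theta \<mu> \<theta> A"
  unfolding H_theta_def by (rule SUP_upper) simp

lemma H_theta_empty: "H_theta \<mu> \<theta> {} = 0"
  by (simp add: H_theta_def H_delta_empty)

lemma H_theta_mono: "A \<subseteq> B \<Longrightarrow> H_theta \<mu> \<theta> A \<le> H_theta \<mu> \<theta> B"
  unfolding H_theta_def by (intro SUP_mono') (rule H_delta_mono)

lemma H_theta_subadditive:
  fixes A :: "nat \<Rightarrow> 'a::metric_space set"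
  shows "H_theta \<mu> \<theta> (\<Union>n. A n) \<le> (\<Sum>n. H_theta \<mu> \<theta> (A n))"
  unfolding H_theta_def[of \<mu> \<theta> "\<Union>n. A n"]
  by (intro SUP_least order_trans[OF H_delta_subadditive] suminf_le summableI H_delta_le_H_theta) simp

text \<open>The two suprema run over independent scales; for each pair of scales a common finer one,
  at most d / 2, brings in the separation of contents.\<close>

lemma H_theta_separated:
  assumes "0 < d" and sep: "\<And>x y. x \<in> A \<Longrightarrow> y \<in> B \<Longrightarrow> d \<le> dist x y"
  shows "H_theta \<mu> \<theta> A + H_theta \<mu> \<theta> B \<le> H_theta \<mu> \<theta> (A \<union> B)"
proof -
  have le: "H_delta \<mu> \<theta> \<delta> A + H_delta \<mu> \<theta> \<delta>' B \<le> H_theta \<mu> \<theta> (A \<union> B)" if "0 < \<delta>" "0 < \<delta>'" for \<delta> \<delta>'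
  proof -
    define t where "t = min (d / 2) (min \<delta> \<delta>')"
    have t: "0 < t" "t \<le> \<delta>" "t \<le> \<delta>'" "2 * t \<le> d" using that assms by (auto simp: t_def)
    have "H_delta \<mu> \<theta> \<delta> A + H_delta \<mu> \<theta> \<delta>' B \<le> H_delta \<mu> \<theta> t A + H_delta \<mu> \<theta> t B"
      using t by (intro add_mono H_delta_antimono)
    also have "\<dots> \<le> H_delta \<mu> \<theta> t (A \<union> B)"
      using t sep by (intro H_delta_separated) (meson order_trans)
    also have "\<dots> \<le> H_theta \<mu> \<theta> (A \<union> B)"
      using t by (intro H_delta_le_H_theta)
    finally show ?thesis .
  qed
  have "H_delta \<mu> \<theta> \<delta> A + H_theta \<mu> \<theta> B \<le> H_theta \<mu> \<theta> (A \<union> B)" if "0 < \<delta>" for \<delta>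
    unfolding H_theta_def[of \<mu> \<theta> B] using le that
    by (subst ennreal_SUP_add_right) (auto intro!: SUP_least)
  then show ?thesis
    unfolding H_theta_def[of \<mu> \<theta> A]
    by (subst ennreal_SUP_add_left[symmetric]) (auto intro!: SUP_least)
qed

text \<open>The trace on S is itself a metric outer measure, so the criterion applies to it
  directly.\<close>

lemma measure_space_H_theta_Int:
  fixes S :: "'a::metric_space set"
  shows "measure_space UNIV (sets borel) (\<lambda>A. H_theta \<mu> \<theta> (A \<inter> S))"
proof (rule measure_space_borel_of_metric_outer_measure)
  show "H_theta \<mu> \<theta> ((\<Union>i. A i) \<inter> S) \<le> (\<Sum>i. H_theta \<mu> \<theta> (A i \<inter> S))" for A :: "nat \<Rightarrow> 'a set"
    using H_theta_subadditive[of \<mu> \<theta> "\<lambda>i. A i \<inter> S"] by (simp add: Int_UN_distrib2)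
  show "H_theta \<mu> \<theta> (A \<inter> S) + H_theta \<mu> \<theta> (B \<inter> S) \<le> H_theta \<mu> \<theta> ((A \<union> B) \<inter> S)"
    if "0 < d" "\<And>x y. x \<in> A \<Longrightarrow> y \<in> B \<Longrightarrow> d \<le> dist x y" for A B and d :: real
    unfolding Int_Un_distrib2 using that by (intro H_theta_separated[of d]) auto
qed (auto simp: H_theta_empty intro: H_theta_mono)

lemma sets_H_restr [simp]: "sets (H_restr \<mu> \<theta> S) = sets borel"
  unfolding H_restr_def using sets.sigma_sets_eq[of borel] by (simp add: sets_measure_of_conv)

lemma emeasure_H_restr:
  fixes S A :: "'a::metric_space set"
  assumes "A \<in> sets borel"
  shows "emeasure (H_restr \<mu> \<theta> S) A = H_theta \<mu> \<theta> (A \<inter> S)"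
  using assms measure_space_H_theta_Int[of \<mu> \<theta> S] sets.sigma_sets_eq[of "borel :: 'a measure"]
  by (simp add: H_restr_def emeasure_measure_of_conv)

section \<open>The norm equivalence\<close>

lemma unif_loc_doublingE:
  assumes "unif_loc_doubling \<mu>"
  obtains C where "\<And>r x. 0 < r \<Longrightarrow> r \<le> 1 \<Longrightarrow>
    emeasure \<mu> (cball x (2 * r)) \<le> ennreal C * emeasure \<mu> (cball x r)"
proof -
  obtain C where "\<forall>r\<in>{0<..1}. \<forall>x. emeasure \<mu> (cball x (2 * r)) \<le> ennreal C * emeasure \<mu> (cball x r)"
    using assms zero_less_one unfolding unif_loc_doubling_def by blast
  then show ?thesis by (intro that[of C]) auto
qed

text \<open>Local finiteness gives some small radius depending on x; doubling climbs from there
  through the dyadic radii up to 1.\<close>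

lemma emeasure_unit_cball_finite:
  assumes sets: "sets \<mu> = sets borel"
    and loc_fin: "locally_finite_meas \<mu>" and doubling: "unif_loc_doubling \<mu>"
  shows "emeasure \<mu> (cball x 1) < top"
proof -
  obtain r where r: "0 < r" "emeasure \<mu> (cball x r) < top"
    using loc_fin unfolding locally_finite_meas_def by auto
  obtain C where C: "\<And>r x. 0 < r \<Longrightarrow> r \<le> 1 \<Longrightarrow> emeasure \<mu> (cball x (2 * r)) \<le> ennreal C * emeasure \<mu> (cball x r)"
    using unif_loc_doublingE[OF doubling] by blast
  have "emeasure \<mu> (cball x ((1/2) ^ n)) < top \<Longrightarrow> emeasure \<mu> (cball x 1) < top" for n :: nat
  proof (induction n)
    case (Suc n)
    have "emeasure \<mu> (cball x (2 * (1/2) ^ Suc n)) \<le> ennreal C * emeasure \<mu> (cball x ((1/2) ^ Suc n))"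
      by (intro C) (auto intro: power_le_one simp del: power_Suc)
    also have "\<dots> < top"
      using Suc.prems by (simp add: ennreal_mult_less_top del: power_Suc)
    finally show ?case using Suc.IH by simp
  qed simp
  moreover obtain n :: nat where n: "(1/2) ^ n < r"
    using real_arch_pow_inv[OF r(1), of "1/2"] by auto
  moreover have "emeasure \<mu> (cball x ((1/2) ^ n)) < top"
  proof -
    have "emeasure \<mu> (cball x ((1/2) ^ n)) \<le> emeasure \<mu> (cball x r)"
      using n by (intro emeasure_mono subset_cball) (auto simp: sets)
    then show ?thesis using r(2) by (rule le_less_trans)
  qed
  ultimately show ?thesis by blast
qed

text \<open>Upper regularity at 2 r, doubling of \<mu>, and lower regularity at r combine to
  \<open>k2 * C / k1\<close>; the power of the radius only helps, since theta > 0. The maximum with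
  1 provides \<open>D_ge_1\<close>.\<close>

lemma ADR_doubling_on:
  fixes \<mu> :: "'a::polish_space measure"
  assumes sets_mu: "sets \<mu> = sets borel" and loc_fin: "locally_finite_meas \<mu>"
    and supp: "full_support \<mu>" and doubling: "unif_loc_doubling \<mu>"
    and theta: "0 < \<theta>" and S: "ADR \<mu> \<theta> S"
  obtains D where "doubling_on (H_restr \<mu> \<theta> S) S D"
proof -
  have closed: "closed S" using S by (simp add: ADR_def)
  obtain k1 k2 where k: "0 < k1" "0 < k2"
    and lower: "\<And>x r. x \<in> S \<Longrightarrow> 0 < r \<Longrightarrow> r \<le> 1 \<Longrightarrow>
      ennreal k1 * emeasure \<mu> (cball x r) * ennreal (r powr (-\<theta>)) \<le> H_theta \<mu> \<theta> (cball x r \<inter> S)"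
    and upper: "\<And>x r. x \<in> S \<Longrightarrow> 0 < r \<Longrightarrow> r \<le> 1 \<Longrightarrow>
      H_theta \<mu> \<theta> (cball x r \<inter> S) \<le> ennreal k2 * emeasure \<mu> (cball x r) * ennreal (r powr (-\<theta>))"
    using S unfolding ADR_def by fastforce
  obtain C0 where C0: "\<And>r x. 0 < r \<Longrightarrow> r \<le> 1 \<Longrightarrow> emeasure \<mu> (cball x (2 * r)) \<le> ennreal C0 * emeasure \<mu> (cball x r)"
    using unif_loc_doublingE[OF doubling] by blast
  \<comment> \<open>The doubling constant is an arbitrary real number; a nonnegative one is needed
    to multiply inside \<open>ennreal\<close>.\<close>
  define C where "C = max 0 C0"
  have C: "0 \<le> C" "ennreal C0 \<le> ennreal C" by (auto simp: C_def ennreal_leI)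
  have mH: "emeasure (H_restr \<mu> \<theta> S) (cball x r) = H_theta \<mu> \<theta> (cball x r \<inter> S)" for x r
    by (rule emeasure_H_restr) simp
  have "doubling_on (H_restr \<mu> \<theta> S) S (max 1 (k2 * C / k1))"
  proof
    have "emeasure (H_restr \<mu> \<theta> S) (- S) = 0"
      using closed by (subst emeasure_H_restr) (auto simp: H_theta_empty)
    then show "AE x in H_restr \<mu> \<theta> S. x \<in> S"
      using closed by (intro AE_I[of _ _ "- S"]) auto
  next
    fix x r assume x: "x \<in> S" "0 < r" "r \<le> (1::real)"
    have "0 < emeasure \<mu> (ball x r)"
      using supp x by (simp add: full_support_def)
    also have "\<dots> \<le> emeasure \<mu> (cball x r)"
      by (intro emeasure_mono) (auto simp: sets_mu)
    finally have pos: "0 < emeasure \<mu> (cball x r)" .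
    have "emeasure \<mu> (cball x r) \<le> emeasure \<mu> (cball x 1)"
      using x by (intro emeasure_mono subset_cball) (auto simp: sets_mu)
    also have "\<dots> < top"
      by (rule emeasure_unit_cball_finite[OF sets_mu loc_fin doubling])
    finally have fin: "emeasure \<mu> (cball x r) < top" .
    have "0 < ennreal k1 * emeasure \<mu> (cball x r) * ennreal (r powr (-\<theta>))"
      using pos k x by (simp add: ennreal_zero_less_mult_iff)
    also have "\<dots> \<le> H_theta \<mu> \<theta> (cball x r \<inter> S)"
      using x by (rule lower)
    finally show "0 < emeasure (H_restr \<mu> \<theta> S) (cball x r)"
      by (simp add: mH)
    have "H_theta \<mu> \<theta> (cball x r \<inter> S) \<le> ennreal k2 * emeasure \<mu> (cball x r) * ennreal (r powr (-\<theta>))"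
      using x by (rule upper)
    also have "\<dots> < top"
      using fin by (simp add: ennreal_mult_less_top)
    finally show "emeasure (H_restr \<mu> \<theta> S) (cball x r) < top"
      by (simp add: mH)
  next
    fix x r assume x: "x \<in> S" "0 < r" "r \<le> (1/2::real)"
    have "H_theta \<mu> \<theta> (cball x (2 * r) \<inter> S) \<le> ennreal k2 * emeasure \<mu> (cball x (2 * r)) * ennreal ((2 * r) powr (-\<theta>))"
      using x by (intro upper) auto
    also have "\<dots> \<le> ennreal k2 * (ennreal C * emeasure \<mu> (cball x r)) * ennreal (r powr (-\<theta>))"
    proof (intro mult_mono mult_left_mono)
      show "emeasure \<mu> (cball x (2 * r)) \<le> ennreal C * emeasure \<mu> (cball x r)"
        using x by (intro order_trans[OF C0] mult_right_mono C) auto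
      show "ennreal ((2 * r) powr (-\<theta>)) \<le> ennreal (r powr (-\<theta>))"
        using x theta by (intro ennreal_leI powr_mono2') auto
    qed auto
    also have "\<dots> = ennreal (k2 * C / k1) * (ennreal k1 * emeasure \<mu> (cball x r) * ennreal (r powr (-\<theta>)))"
    proof -
      have "ennreal k2 * ennreal C = ennreal (k2 * C / k1) * ennreal k1"
        using k C by (simp flip: ennreal_mult)
      then show ?thesis by (simp only: mult.assoc[symmetric])
    qed
    also have "\<dots> \<le> ennreal (max 1 (k2 * C / k1)) * H_theta \<mu> \<theta> (cball x r \<inter> S)"
      using x by (intro mult_mono ennreal_leI lower) auto
    finally show "emeasure (H_restr \<mu> \<theta> S) (cball x (2 * r)) \<le>
        ennreal (max 1 (k2 * C / k1)) * emeasure (H_restr \<mu> \<theta> S) (cball x r)"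
      by (simp add: mH)
  qed auto
  then show ?thesis by (rule that)
qed

theorem theorem2p3:
  fixes \<mu> :: "'a::polish_space measure" and p \<theta> s :: real and S :: "'a set"
  assumes sets_mu: "sets \<mu> = sets borel"
    and loc_fin: "locally_finite_meas \<mu>"
    and supp: "full_support \<mu>"
    and doubling: "unif_loc_doubling \<mu>"
    and p_gt: "1 < p"
    and poincare: "weak_local_poincare \<mu> p"
    and theta: "0 < \<theta>" "\<theta> < lower_Q \<mu>"
    and S_ADR: "ADR \<mu> \<theta> S"
    and s_pos: "0 < s"
  shows "(\<forall>f \<in> Lp_space (H_restr \<mu> \<theta> S) p.
            f \<in> besov_space \<mu> \<theta> S s p \<longleftrightarrow> BN_tilde \<mu> \<theta> S s p f < \<infinity>)
       \<and> (\<exists>C>0. \<forall>f \<in> Lp_space (H_restr \<mu> \<theta> S) p.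
            ennreal (1/C) * besov_norm \<mu> \<theta> S s p f
              \<le> Lp_norm (H_restr \<mu> \<theta> S) p f + BN_tilde \<mu> \<theta> S s p f
          \<and> Lp_norm (H_restr \<mu> \<theta> S) p f + BN_tilde \<mu> \<theta> S s p f
              \<le> ennreal C * besov_norm \<mu> \<theta> S s p f)"
proof -
  define m where "m = H_restr \<mu> \<theta> S"
  obtain D where "doubling_on m S D"
    unfolding m_def using ADR_doubling_on[OF sets_mu loc_fin supp doubling theta(1) S_ADR] by blast
  then interpret doubling_on m S D .
  define Q where "Q = 2 powr (s * p / 2)"
  \<comment> \<open>The constant of \<open>lp_osc_sum_le\<close> written out, which shows that it
    does not depend on f.\<close>
  define K where "K = Q\<^sup>2 * (2 powr p * (1 + D)) +
    (4 powr p * (1 + D) * (2 powr p * (1 / (1 - 2 powr (- (s / 2)))) powr p * (D + 1) powr p) * (Q / (Q - 1)) +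
     4 powr p * (D + D * D) powr p * Q\<^sup>2)"
  \<comment> \<open>The 2 is the p-th root of the Jensen factor 2^p and serves one inequality; in
    the other, 2^(1/p) comes from splitting the root of N + E.\<close>
  define C where "C = 2 + K powr (1/p) * 2 powr (1/p)"
  have Q: "1 < Q" using s_pos p_gt by (simp add: Q_def)
  have K: "0 < K" unfolding K_def using Q D_ge_1 by (intro add_pos_nonneg) auto
  have C: "2 \<le> C" by (simp add: C_def)
  have main: "besov_norm \<mu> \<theta> S s p f \<le> ennreal C * (Lp_norm m p f + BN_tilde \<mu> \<theta> S s p f)"
    "Lp_norm m p f + BN_tilde \<mu> \<theta> S s p f \<le> ennreal C * besov_norm \<mu> \<theta> S s p f"
    if f: "f \<in> Lp_space m p" for f
  proof -
    have f_meas [measurable]: "f \<in> borel_measurable m" and fin: "(\<integral>\<^sup>+ x. ennreal (\<bar>f x\<bar> powr p) \<partial>m) < top"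
      using f by (auto simp: Lp_space_def)
    note f_ctxt = f_meas p_gt fin
    define N where "N = (\<integral>\<^sup>+ x. ennreal (\<bar>f x\<bar> powr p) \<partial>m)"
    define E where "E = (\<Sum>k. if 1 \<le> k then ennreal (2 powr (real k * s * p)) * mean_osc_int f p (dyadic k) else 0)"
    define T where "T = (\<Sum>k. if 1 \<le> k then ennreal (2 powr (real k * s * p)) * lp_osc p (dyadic k) f else 0)"
    have Lp: "Lp_norm m p f = enn_powr N (1/p)"
      by (simp add: Lp_norm_def N_def)
    have besov: "besov_norm \<mu> \<theta> S s p f = Lp_norm m p f + enn_powr E (1/p)"
    proof -
      have eq: "(\<integral>\<^sup>+ x\<in>S. enn_powr (mean_osc m f (cball x (dyadic k))) p \<partial>m) = mean_osc_int f p (dyadic k)" for k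
        unfolding mean_osc_int_def[OF f_ctxt]
        using AE_S by (intro nn_integral_cong_AE) (auto elim!: eventually_mono)
      show ?thesis
        unfolding besov_norm_def E_def m_def[symmetric] dyadic_def[symmetric] eq ..
    qed
    have BN: "BN_tilde \<mu> \<theta> S s p f = enn_powr T (1/p)"
    proof -
      have eq: "(\<integral>\<^sup>+ x\<in>S. (1 / H_theta \<mu> \<theta> (cball x (dyadic k) \<inter> S)) *
            (\<integral>\<^sup>+ y\<in>cball x (dyadic k) \<inter> S. ennreal (\<bar>f x - f y\<bar> powr p) \<partial>m) \<partial>m) = lp_osc p (dyadic k) f" for k
        unfolding lp_osc_def
      proof (rule nn_integral_cong_AE)
        have inner: "(\<integral>\<^sup>+ y\<in>cball x (dyadic k) \<inter> S. ennreal (\<bar>f x - f y\<bar> powr p) \<partial>m) =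
            (\<integral>\<^sup>+ y\<in>cball x (dyadic k). ennreal (\<bar>f x - f y\<bar> powr p) \<partial>m)" for x
          using AE_S by (intro nn_integral_cong_AE) (auto elim!: eventually_mono simp: indicator_def)
        have H: "H_theta \<mu> \<theta> (cball x (dyadic k) \<inter> S) = emeasure m (cball x (dyadic k))" for x
          unfolding m_def by (subst emeasure_H_restr) auto
        show "AE x in m. (1 / H_theta \<mu> \<theta> (cball x (dyadic k) \<inter> S)) *
            (\<integral>\<^sup>+ y\<in>cball x (dyadic k) \<inter> S. ennreal (\<bar>f x - f y\<bar> powr p) \<partial>m) * indicator S x =
            ball_avg (dyadic k) (\<lambda>y. ennreal (\<bar>f x - f y\<bar> powr p)) x"
          using AE_S unfolding inner H ball_avg_def
          by eventually_elim (simp add: divide_ennreal_def mult.commute)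
      qed
      show ?thesis
        unfolding BN_tilde_def T_def m_def[symmetric] dyadic_def[symmetric] eq ..
    qed
    have "enn_powr E (1/p) \<le> enn_powr (ennreal (2 powr p) * T) (1/p)"
      using p_gt mean_osc_sum_le_lp_osc_sum[OF f_ctxt, of s] unfolding E_def T_def by (intro enn_powr_mono) auto
    also have "\<dots> = ennreal 2 * enn_powr T (1/p)"
      using p_gt by (subst enn_powr_mult) (auto simp: powr_powr)
    finally have "enn_powr E (1/p) \<le> ennreal 2 * enn_powr T (1/p)" .
    then have "Lp_norm m p f + enn_powr E (1/p) \<le> ennreal 2 * Lp_norm m p f + ennreal 2 * enn_powr T (1/p)"
      using mult_right_mono[of 1 "ennreal 2" "Lp_norm m p f"] by (intro add_mono) auto
    also have "\<dots> \<le> ennreal C * (Lp_norm m p f + enn_powr T (1/p))"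
      unfolding distrib_left[symmetric] using C by (intro mult_right_mono ennreal_leI) auto
    finally show "besov_norm \<mu> \<theta> S s p f \<le> ennreal C * (Lp_norm m p f + BN_tilde \<mu> \<theta> S s p f)"
      unfolding besov BN .
    have "T \<le> ennreal K * (N + E)"
      unfolding T_def N_def E_def K_def Q_def by (rule lp_osc_sum_le[OF f_ctxt s_pos])
    then have "enn_powr T (1/p) \<le> enn_powr (ennreal K * (N + E)) (1/p)"
      using p_gt by (intro enn_powr_mono) auto
    also have "\<dots> = ennreal (K powr (1/p)) * enn_powr (N + E) (1/p)"
      using K by (rule enn_powr_mult)
    also have "\<dots> \<le> ennreal (K powr (1/p)) * (ennreal (2 powr (1/p)) * (enn_powr N (1/p) + enn_powr E (1/p)))"
      using p_gt by (intro mult_left_mono enn_powr_add_le) auto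
    also have "\<dots> = ennreal (K powr (1/p) * 2 powr (1/p)) * besov_norm \<mu> \<theta> S s p f"
      unfolding besov Lp by (simp add: ennreal_mult mult.assoc)
    finally have "Lp_norm m p f + BN_tilde \<mu> \<theta> S s p f \<le>
        ennreal 1 * besov_norm \<mu> \<theta> S s p f + ennreal (K powr (1/p) * 2 powr (1/p)) * besov_norm \<mu> \<theta> S s p f"
      unfolding BN by (intro add_mono) (auto simp: besov)
    also have "\<dots> = ennreal (1 + K powr (1/p) * 2 powr (1/p)) * besov_norm \<mu> \<theta> S s p f"
      by (simp add: distrib_right)
    also have "\<dots> \<le> ennreal C * besov_norm \<mu> \<theta> S s p f"
      by (intro mult_right_mono ennreal_leI) (auto simp: C_def)
    finally show "Lp_norm m p f + BN_tilde \<mu> \<theta> S s p f \<le> ennreal C * besov_norm \<mu> \<theta> S s p f" .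
  qed
  have lower: "ennreal (1/C) * besov_norm \<mu> \<theta> S s p f \<le> Lp_norm m p f + BN_tilde \<mu> \<theta> S s p f"
    if f: "f \<in> Lp_space m p" for f
  proof -
    have "ennreal (1/C) * besov_norm \<mu> \<theta> S s p f \<le>
        ennreal (1/C) * (ennreal C * (Lp_norm m p f + BN_tilde \<mu> \<theta> S s p f))"
      by (intro mult_left_mono main(1) f) auto
    also have "\<dots> = ennreal (1/C * C) * (Lp_norm m p f + BN_tilde \<mu> \<theta> S s p f)"
      using C by (subst ennreal_mult) (simp_all add: mult.assoc)
    also have "1/C * C = 1" using C by simp
    finally show ?thesis by simp
  qed
  \<comment> \<open>The L_p norm is finite here, so finiteness passes between the two sums and hence
    to \<open>BN_tilde\<close> alone.\<close>
  have "f \<in> besov_space \<mu> \<theta> S s p \<longleftrightarrow> BN_tilde \<mu> \<theta> S s p f < \<infinity>" if f: "f \<in> Lp_space m p" for f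
  proof -
    have Lp: "Lp_norm m p f < top"
      using f by (auto simp: Lp_norm_def Lp_space_def enn_powr_less_top_iff)
    have "BN_tilde \<mu> \<theta> S s p f < top" if "besov_norm \<mu> \<theta> S s p f < top"
      using le_less_trans[OF main(2)[OF f], of top] that by (simp add: ennreal_mult_less_top)
    moreover have "besov_norm \<mu> \<theta> S s p f < top" if "BN_tilde \<mu> \<theta> S s p f < top"
      using le_less_trans[OF main(1)[OF f], of top] that Lp by (simp add: ennreal_mult_less_top)
    ultimately show ?thesis
      using f by (auto simp: besov_space_def m_def)
  qed
  moreover have "\<exists>C>0. \<forall>f \<in> Lp_space m p.
      ennreal (1/C) * besov_norm \<mu> \<theta> S s p f \<le> Lp_norm m p f + BN_tilde \<mu> \<theta> S s p f \<and>
      Lp_norm m p f + BN_tilde \<mu> \<theta> S s p f \<le> ennreal C * besov_norm \<mu> \<theta> S s p f"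
    using C lower main(2) by (intro exI[of _ C]) auto
  ultimately show ?thesis
    unfolding m_def by blast
qed

end
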